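(* $\mathrm{MC}(\mathtt{FKS},\mathtt{CCTL^*})$ is reducible to the satisfiability problem of $\mathtt{PH}$ in polynomial time: there is a polynomial-time computable map sending each flat Kripke structure $\mathcal{K}$ and $\mathtt{CCTL^*}$ formula $\Phi$ to a $\mathtt{PH}$ formula that is satisfiable if and only if $\mathcal{K}\models\Phi$.
   Context: $\mathtt{PH}$: formulae over variables $V$ given by $\varphi ::= \tau\le\tau\mid\neg\varphi\mid\varphi\land\varphi\mid\exists x.\varphi\mid\exists^{=x}y.\varphi$, terms $\tau ::= a\mid a\cdot x\mid\tau+\tau$ with $a\in\mathbb{N}$, $x,y\in V$. Semantics over valuations $\eta:V\to\mathbb{N}$ as usual for first-order logic over $(\mathbb{N},+)$, with $\eta\models\exists^{=x}y.\varphi$ iff $\{b\in\mathbb{N}\mid\eta[y\mapsto b]\models\varphi\}$ is finite and of cardinality $\eta(x)$. Satisfiability: existence of a satisfying $\eta$. Kripke structure $\mathcal{K}=(S,s_I,E,\lambda)$: finite $S$, $s_I\in S$, $E\subseteq S\times S$, $\lambda:S\to2^{AP}$ ($AP$ finite). Runs: infinite paths $\rho$ with $\rho(0)=s_I$; $\mathtt{Runs}(\mathcal{K})$. Simple loop: finite path of pairwise distinct states $s_0\dots s_k$ with $(s_k,s_0)\in E$; $\mathcal{K}$ is flat if each state is the first state of at most one simple loop; $\mathtt{FKS}$ is the class of flat Kripke structures. $\mathtt{CCTL^*}$ over variables $V$: $\varphi ::= p\mid\varphi\land\varphi\mid\neg\varphi\mid\mathtt{X}\varphi\mid\varphi\mathtt{U}\varphi\mid\mathtt{E}\varphi\mid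 x.\varphi\mid\tau\le\tau$, $\tau ::= a\mid a\cdot\#_x(\varphi)\mid\tau+\tau$ ($p\in AP$, $x\in V$, $a\in\mathbb{Z}$, numbers in binary). Semantics over a run $\rho$, position $i$, valuation $\theta:V\to\mathbb{N}$: $p$ iff $p\in\lambda(\rho(i))$; Booleans usual; $\mathtt{X}\varphi$ iff $(\rho,i+1,\theta)\models\varphi$; $\varphi\mathtt{U}\psi$ iff some $k\ge i$ has $(\rho,k,\theta)\models\psi$ and $(\rho,j,\theta)\models\varphi$ for all $j\in[i,k-1]$; $\mathtt{E}\varphi$ iff some $\rho'\in\mathtt{Runs}(\mathcal{K})$ agrees with $\rho$ on positions $0..i$ and $(\rho',i,\theta)\models\varphi$; $x.\varphi$ iff $(\rho,i,\theta[x\mapsto i])\models\varphi$; $\tau_1\le\tau_2$ iff $[\![\tau_1]\!]\le[\![\tau_2]\!]$, where $[\![a]\!]=a$, $[\![\tau_1+\tau_2]\!]$ is the sum, $[\![a\cdot\#_x(\varphi)]\!]=a\cdot|\{j\mid\theta(x)\le j\le i,(\rho,j,\theta)\models\varphi\}|$. A state $s$ satisfies $\varphi$ if some $\rho\in\mathtt{Runs}(\mathcal{K})$ and $i$ have $\rho(i)=s$ and $(\rho,i,\mathbf{0})\models\varphi$; $\mathcal{K}\models\varphi$ iff $s_I$ satisfies $\varphi$. $\mathrm{MC}(\mathfrak{K},\mathcal{L})$: given $\mathcal{K}\in\mathfrak{K}$, $\varphi\in\mathcal{L}$, decide $\mathcal{K}\models\varphi$. *)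

theory Defs
  imports Main
begin

datatype ph_term =
    PConst nat
  | PMul nat nat
  | PAdd ph_term ph_term

datatype ph_form =
    PLe ph_term ph_term
  | PNot ph_form
  | PAnd ph_form ph_form
  | PEx nat ph_form
  | PCount nat nat ph_form

fun ph_eval :: "(nat \<Rightarrow> nat) \<Rightarrow> ph_term \<Rightarrow> nat" where
  "ph_eval \<eta> (PConst a) = a"
| "ph_eval \<eta> (PMul a x) = a * \<eta> x"
| "ph_eval \<eta> (PAdd t1 t2) = ph_eval \<eta> t1 + ph_eval \<eta> t2"

fun ph_sat :: "(nat \<Rightarrow> nat) \<Rightarrow> ph_form \<Rightarrow> bool" where
  "ph_sat \<eta> (PLe t1 t2) = (ph_eval \<eta> t1 \<le> ph_eval \<eta> t2)"
| "ph_sat \<eta> (PNot \<phi>) = (\<not> ph_sat \<eta> \<phi>)"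
| "ph_sat \<eta> (PAnd \<phi> \<psi>) = (ph_sat \<eta> \<phi> \<and> ph_sat \<eta> \<psi>)"
| "ph_sat \<eta> (PEx x \<phi>) = (\<exists>b. ph_sat (\<eta>(x := b)) \<phi>)"
| "ph_sat \<eta> (PCount x y \<phi>) =
     (finite {b. ph_sat (\<eta>(y := b)) \<phi>} \<and> card {b. ph_sat (\<eta>(y := b)) \<phi>} = \<eta> x)"

definition ph_satisfiable :: "ph_form \<Rightarrow> bool" where
  "ph_satisfiable \<phi> \<longleftrightarrow> (\<exists>\<eta>. ph_sat \<eta> \<phi>)"

datatype kripke = Kripke (ks_n: nat) (ks_init: nat) (ks_edges: "(nat \<times> nat) list")
                         (ks_labels: "nat list list")

definition ks_states :: "kripke \<Rightarrow> nat set" where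
  "ks_states K = {0..<ks_n K}"

definition ks_E :: "kripke \<Rightarrow> (nat \<times> nat) set" where
  "ks_E K = set (ks_edges K)"

definition ks_lab :: "kripke \<Rightarrow> nat \<Rightarrow> nat set" where
  "ks_lab K s = set (ks_labels K ! s)"

definition ks_wf :: "kripke \<Rightarrow> bool" where
  "ks_wf K \<longleftrightarrow> ks_init K \<in> ks_states K
     \<and> ks_E K \<subseteq> ks_states K \<times> ks_states K
     \<and> length (ks_labels K) = ks_n K"

definition simple_loop :: "kripke \<Rightarrow> nat list \<Rightarrow> bool" where
  "simple_loop K xs \<longleftrightarrow> xs \<noteq> [] \<and> distinct xs \<and> set xs \<subseteq> ks_states K
     \<and> (\<forall>i. Suc i < length xs \<longrightarrow> (xs ! i, xs ! Suc i) \<in> ks_E K)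
     \<and> (last xs, hd xs) \<in> ks_E K"

definition flat :: "kripke \<Rightarrow> bool" where
  "flat K \<longleftrightarrow> (\<forall>xs ys. simple_loop K xs \<and> simple_loop K ys \<and> hd xs = hd ys \<longrightarrow> xs = ys)"

definition FKS :: "kripke \<Rightarrow> bool" where
  "FKS K \<longleftrightarrow> ks_wf K \<and> flat K"

definition is_run :: "kripke \<Rightarrow> (nat \<Rightarrow> nat) \<Rightarrow> bool" where
  "is_run K \<rho> \<longleftrightarrow> \<rho> 0 = ks_init K \<and> (\<forall>i. (\<rho> i, \<rho> (Suc i)) \<in> ks_E K)"

datatype cform =
    CAP nat
  | CAnd cform cform
  | CNot cform
  | CX cform
  | CU cform cform
  | CE cform
  | CBind nat cform
  | CLe cterm cterm
and cterm =
    CConst int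
  | CCount int nat cform
  | CAdd cterm cterm

fun csat :: "kripke \<Rightarrow> (nat \<Rightarrow> nat) \<Rightarrow> nat \<Rightarrow> (nat \<Rightarrow> nat) \<Rightarrow> cform \<Rightarrow> bool"
and cval :: "kripke \<Rightarrow> (nat \<Rightarrow> nat) \<Rightarrow> nat \<Rightarrow> (nat \<Rightarrow> nat) \<Rightarrow> cterm \<Rightarrow> int" where
  "csat K \<rho> i \<theta> (CAP p) = (p \<in> ks_lab K (\<rho> i))"
| "csat K \<rho> i \<theta> (CAnd \<phi> \<psi>) = (csat K \<rho> i \<theta> \<phi> \<and> csat K \<rho> i \<theta> \<psi>)"
| "csat K \<rho> i \<theta> (CNot \<phi>) = (\<not> csat K \<rho> i \<theta> \<phi>)"
| "csat K \<rho> i \<theta> (CX \<phi>) = csat K \<rho> (Suc i) \<theta> \<phi>"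
| "csat K \<rho> i \<theta> (CU \<phi> \<psi>) =
     (\<exists>k\<ge>i. csat K \<rho> k \<theta> \<psi> \<and> (\<forall>j. i \<le> j \<and> j < k \<longrightarrow> csat K \<rho> j \<theta> \<phi>))"
| "csat K \<rho> i \<theta> (CE \<phi>) =
     (\<exists>\<rho>'. is_run K \<rho>' \<and> (\<forall>j\<le>i. \<rho>' j = \<rho> j) \<and> csat K \<rho>' i \<theta> \<phi>)"
| "csat K \<rho> i \<theta> (CBind x \<phi>) = csat K \<rho> i (\<theta>(x := i)) \<phi>"
| "csat K \<rho> i \<theta> (CLe t1 t2) = (cval K \<rho> i \<theta> t1 \<le> cval K \<rho> i \<theta> t2)"
| "cval K \<rho> i \<theta> (CConst a) = a"
| "cval K \<rho> i \<theta> (CCount a x \<phi>) =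
     a * int (card {j. \<theta> x \<le> j \<and> j \<le> i \<and> csat K \<rho> j \<theta> \<phi>})"
| "cval K \<rho> i \<theta> (CAdd t1 t2) = cval K \<rho> i \<theta> t1 + cval K \<rho> i \<theta> t2"

definition state_sat :: "kripke \<Rightarrow> nat \<Rightarrow> cform \<Rightarrow> bool" where
  "state_sat K s \<phi> \<longleftrightarrow> (\<exists>\<rho> i. is_run K \<rho> \<and> \<rho> i = s \<and> csat K \<rho> i (\<lambda>_. 0) \<phi>)"

definition models :: "kripke \<Rightarrow> cform \<Rightarrow> bool" where
  "models K \<phi> \<longleftrightarrow> state_sat K (ks_init K) \<phi>"

section \<open>String encodings (alphabet: symbols 1..26, 0 is the blank)\<close>

text \<open>Natural numbers in binary, least significant bit first (1 = bit 0, 2 = bit 1),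
  terminated by 3.  All encodings are prefix-free.\<close>

fun enc_nat :: "nat \<Rightarrow> nat list" where
  "enc_nat n = (if n = 0 then [3] else (if even n then 1 else 2) # enc_nat (n div 2))"

declare enc_nat.simps [simp del]

definition enc_int :: "int \<Rightarrow> nat list" where
  "enc_int k = (if 0 \<le> k then 4 else 5) # enc_nat (nat \<bar>k\<bar>)"

definition enc_list :: "('a \<Rightarrow> nat list) \<Rightarrow> 'a list \<Rightarrow> nat list" where
  "enc_list f xs = 6 # concat (map f xs) @ [7]"

definition enc_kripke :: "kripke \<Rightarrow> nat list" where
  "enc_kripke K = enc_nat (ks_n K) @ enc_nat (ks_init K)
     @ enc_list (\<lambda>(a, b). enc_nat a @ enc_nat b) (ks_edges K)
     @ enc_list (enc_list enc_nat) (ks_labels K)"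

fun enc_cform :: "cform \<Rightarrow> nat list"
and enc_cterm :: "cterm \<Rightarrow> nat list" where
  "enc_cform (CAP p) = 8 # enc_nat p"
| "enc_cform (CAnd \<phi> \<psi>) = 9 # enc_cform \<phi> @ enc_cform \<psi>"
| "enc_cform (CNot \<phi>) = 10 # enc_cform \<phi>"
| "enc_cform (CX \<phi>) = 11 # enc_cform \<phi>"
| "enc_cform (CU \<phi> \<psi>) = 12 # enc_cform \<phi> @ enc_cform \<psi>"
| "enc_cform (CE \<phi>) = 13 # enc_cform \<phi>"
| "enc_cform (CBind x \<phi>) = 14 # enc_nat x @ enc_cform \<phi>"
| "enc_cform (CLe t1 t2) = 15 # enc_cterm t1 @ enc_cterm t2"
| "enc_cterm (CConst a) = 16 # enc_int a"
| "enc_cterm (CCount a x \<phi>) = 17 # enc_int a @ enc_nat x @ enc_cform \<phi>"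
| "enc_cterm (CAdd t1 t2) = 18 # enc_cterm t1 @ enc_cterm t2"

fun enc_ph_term :: "ph_term \<Rightarrow> nat list" where
  "enc_ph_term (PConst a) = 19 # enc_nat a"
| "enc_ph_term (PMul a x) = 20 # enc_nat a @ enc_nat x"
| "enc_ph_term (PAdd t1 t2) = 21 # enc_ph_term t1 @ enc_ph_term t2"

fun enc_ph :: "ph_form \<Rightarrow> nat list" where
  "enc_ph (PLe t1 t2) = 22 # enc_ph_term t1 @ enc_ph_term t2"
| "enc_ph (PNot \<phi>) = 23 # enc_ph \<phi>"
| "enc_ph (PAnd \<phi> \<psi>) = 24 # enc_ph \<phi> @ enc_ph \<psi>"
| "enc_ph (PEx x \<phi>) = 25 # enc_nat x @ enc_ph \<phi>"
| "enc_ph (PCount x y \<phi>) = 26 # enc_nat x @ enc_nat y @ enc_ph \<phi>"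

definition enc_instance :: "kripke \<Rightarrow> cform \<Rightarrow> nat list" where
  "enc_instance K \<phi> = enc_kripke K @ enc_cform \<phi>"

datatype move = GoL | GoR | Stay

text \<open>TM nq ns delta: states 0..<nq (0 initial, 1 halting), tape symbols 0..<ns
  (0 blank), transition function delta (only its values on states < nq and
  symbols < ns matter).  The tape is one-way infinite (cells indexed by nat).\<close>

datatype tm = TM (tm_nq: nat) (tm_ns: nat) (tm_delta: "nat \<Rightarrow> nat \<Rightarrow> nat \<times> nat \<times> move")

definition tm_wf :: "tm \<Rightarrow> bool" where
  "tm_wf M \<longleftrightarrow> 2 \<le> tm_nq M \<and> 27 \<le> tm_ns M
     \<and> (\<forall>q a. q < tm_nq M \<and> a < tm_ns M \<longrightarrow>
          (case tm_delta M q a of (q', b, m) \<Rightarrow> q' < tm_nq M \<and> b < tm_ns M))"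

type_synonym config = "nat \<times> (nat \<Rightarrow> nat) \<times> nat"

definition tm_step :: "tm \<Rightarrow> config \<Rightarrow> config" where
  "tm_step M c = (case c of (q, t, h) \<Rightarrow>
     if q = 1 then (q, t, h)
     else (case tm_delta M q (t h) of (q', b, m) \<Rightarrow>
             (q', t(h := b), (case m of GoL \<Rightarrow> h - 1 | GoR \<Rightarrow> Suc h | Stay \<Rightarrow> h))))"

definition tm_init :: "nat list \<Rightarrow> config" where
  "tm_init w = (0, (\<lambda>i. if i < length w then w ! i else 0), 0)"

definition tape_out :: "(nat \<Rightarrow> nat) \<Rightarrow> nat list" where
  "tape_out t = map t [0..<(LEAST k. t k = 0)]"

definition tm_computes_within :: "tm \<Rightarrow> nat \<Rightarrow> nat list \<Rightarrow> nat list \<Rightarrow> bool" where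
  "tm_computes_within M T w v \<longleftrightarrow>
     (\<exists>s\<le>T. fst ((tm_step M ^^ s) (tm_init w)) = 1
            \<and> tape_out (fst (snd ((tm_step M ^^ s) (tm_init w)))) = v)"

definition polytime_reduction_map :: "(kripke \<Rightarrow> cform \<Rightarrow> ph_form) \<Rightarrow> bool" where
  "polytime_reduction_map f \<longleftrightarrow>
     (\<exists>M c d. tm_wf M \<and>
        (\<forall>K \<phi>. FKS K \<longrightarrow>
           tm_computes_within M (c * (length (enc_instance K \<phi>) + 1) ^ d)
             (enc_instance K \<phi>) (enc_ph (f K \<phi>))))"

end

(*
In a flat structure, a state of a loop has a unique successor from which it can be reached again.
Hence the positions at which a run visits a given state are f, f + p, f + 2 p, ... below some bound g
(or without bound), where p is at most the number of edges. Three numbers per state therefore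
describe a run, and Presburger formulas can say that the numbers describe some run, that two runs
agree up to a position, and in which state the run is at a position. Counting quantifiers express
the counting terms.

A formula in prefix notation is translated into a prefix, which depends on the root symbol and the
structure, followed by the translations of the subformulas. Thus the output is written by a two-way
head with one pebble that sweeps over the structure at each symbol of the formula. A halting
computation of such a device repeats no configuration, so it is polynomially long.
*)

theory Submission imports Defs
begin


section \<open>Runs of flat structures\<close>

text \<open>The progression f + p * k multiplies two unknowns, which Presburger arithmetic cannot
  express. This is why the bound on the period matters: the product can be unfolded, one step per
  edge. Arbitrary numbers need not describe a run, so a validity formula has to demand one state per
  position and an edge between successive states. Only sources of edges get numbers, since every
  state of an infinite run is one.

  The writing device has no memory for the nesting of the formula. A translation therefore mentions
  each subformula once, in order, and communicates through a fixed stock of variables that are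
  quantified anew at every level. A second mention would also make the output exponential. As PH
  knows natural numbers only, the integer value of a counting term is represented as a difference of
  two variables.\<close>

lemma rtrancl_distinct_path:
  assumes "(u, t) \<in> E\<^sup>*"
  shows "\<exists>xs. xs \<noteq> [] \<and> hd xs = u \<and> last xs = t \<and> distinct xs
    \<and> successively (\<lambda>a b. (a, b) \<in> E) xs"
  using assms
proof (induction rule: converse_rtrancl_induct)
  case base
  show ?case by (rule exI[of _ "[t]"]) simp
next
  case (step y z)
  then obtain xs where xs: "xs \<noteq> []" "hd xs = z" "last xs = t" "distinct xs"
    "successively (\<lambda>a b. (a, b) \<in> E) xs" by blast
  show ?case
  proof (cases "y \<in> set xs")
    case True
    \<comment> \<open>The path already meets \<open>y\<close>: cut off the detour and keep the part
      from \<open>y\<close> on.\<close>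
    then obtain ys zs where "xs = ys @ y # zs" by (meson split_list)
    with xs show ?thesis
      by (intro exI[of _ "y # zs"]) (auto simp: successively_append_iff)
  next
    case False
    with xs step(1) show ?thesis
      by (intro exI[of _ "y # xs"]) (auto simp: successively_Cons)
  qed
qed

text \<open>A shortest way back closes the edge to a simple loop. \<open>hd (ys @ [t])\<close> is
  the second state of the loop read cyclically, so that a self-loop, with \<open>ys = []\<close>, is
  covered too.\<close>

lemma simple_loop_through:
  assumes wf: "ks_wf K" and e: "(t, u) \<in> ks_E K" and r: "(u, t) \<in> (ks_E K)\<^sup>*"
  shows "\<exists>ys. simple_loop K (t # ys) \<and> hd (ys @ [t]) = u"
proof -
  obtain xs where xs: "xs \<noteq> []" "hd xs = u" "last xs = t" "distinct xs"
    "successively (\<lambda>a b. (a, b) \<in> ks_E K) xs"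
    using rtrancl_distinct_path[OF r] by blast
  define ys where "ys = butlast xs"
  have xeq: "xs = ys @ [t]" using xs(1,3) unfolding ys_def by (metis append_butlast_last_id)
  have suc: "successively (\<lambda>a b. (a, b) \<in> ks_E K) (t # ys @ [t])"
    using xs xeq e by (cases "ys @ [t]") auto
  have ed: "(t # ys @ [t]) ! i \<in> ks_states K" if "i < Suc (Suc (length ys))" for i
  proof (cases "i = Suc (length ys)")
    case True
    then show ?thesis using wf e by (auto simp: ks_wf_def nth_append)
  next
    case False
    then have "((t # ys @ [t]) ! i, (t # ys @ [t]) ! Suc i) \<in> ks_E K"
      using suc that unfolding successively_conv_nth by auto
    then show ?thesis using wf by (auto simp: ks_wf_def)
  qed
  have sub: "set (t # ys) \<subseteq> ks_states K"
  proof
    fix x assume "x \<in> set (t # ys)"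
    then obtain i where "i < Suc (length ys)" "(t # ys) ! i = x"
      by (metis in_set_conv_nth length_Cons)
    moreover have "(t # ys @ [t]) ! i = (t # ys) ! i"
      using \<open>i < Suc (length ys)\<close> by (metis append_Cons length_Cons nth_append)
    ultimately show "x \<in> ks_states K" using ed[of i] by simp
  qed
  have eds: "\<forall>i. Suc i < length (t # ys) \<longrightarrow> ((t # ys) ! i, (t # ys) ! Suc i) \<in> ks_E K"
    using suc unfolding append_Cons[symmetric] successively_append_iff
    by (metis append_Cons successively_append_iff successively_conv_nth suc)
  have lst: "(last (t # ys), hd (t # ys)) \<in> ks_E K"
    using suc unfolding append_Cons[symmetric] successively_append_iff by auto
  have "simple_loop K (t # ys)"
    unfolding simple_loop_def using sub eds lst xs(4) xeq by auto
  then show ?thesis using xs(2) xeq by blast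
qed

text \<open>Both edges extend to simple loops starting at \<open>t\<close>. Flatness makes these
  loops equal, hence also their second states.\<close>

lemma flat_successor_unique:
  assumes "FKS K" "(t, u) \<in> ks_E K" "(u, t) \<in> (ks_E K)\<^sup>*"
    "(t, u') \<in> ks_E K" "(u', t) \<in> (ks_E K)\<^sup>*"
  shows "u = u'"
  using simple_loop_through[of K t u] simple_loop_through[of K t u'] assms
  unfolding FKS_def flat_def by (metis list.sel(1,3))

lemma run_reach: "is_run K \<rho> \<Longrightarrow> i \<le> j \<Longrightarrow> (\<rho> i, \<rho> j) \<in> (ks_E K)\<^sup>*"
proof (induction j)
  case (Suc j)
  then show ?case
    by (cases "i = Suc j") (auto simp: is_run_def intro: rtrancl_into_rtrancl)
qed auto

lemma funpow_periodic:
  fixes f :: "'a \<Rightarrow> 'a"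
  assumes "0 < p" "(f ^^ p) x = x" "\<And>q. 0 < q \<Longrightarrow> q < p \<Longrightarrow> (f ^^ q) x \<noteq> x"
  shows "(f ^^ n) x = x \<longleftrightarrow> (\<exists>k. n = p * k)"
proof -
  have m: "(f ^^ (p * k)) x = x" for k
    by (induction k) (auto simp: funpow_add assms(2))
  have "(f ^^ n) x = (f ^^ (n mod p)) ((f ^^ (p * (n div p))) x)"
    by (metis comp_apply funpow_add mod_mult_div_eq)
  then have "(f ^^ n) x = (f ^^ (n mod p)) x" using m by simp
  then have "(f ^^ n) x = x \<longleftrightarrow> n mod p = 0"
    using assms(3)[of "n mod p"] assms(1) by (cases "n mod p = 0") auto
  then show ?thesis by (auto simp: mod_eq_0_iff_dvd elim: dvdE)
qed

text \<open>Between two visits to \<open>s\<close> the run has no choice, so it iterates a function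
  there and returns after multiples of the least period. The value \<open>g = 0\<close> encodes that
  there is no last visit to cut off at.\<close>

lemma flat_run_visits:
  assumes K: "FKS K" and run: "is_run K \<rho>"
  shows "\<exists>f g p. p \<le> length (ks_edges K) \<and>
    (\<forall>i. \<rho> i = s \<longleftrightarrow> (\<exists>k. i = f + p * k) \<and> (g = 0 \<or> i < g))"
proof -
  consider (none) "\<forall>i. \<rho> i \<noteq> s" | (one) f where "\<rho> f = s" "\<forall>i. \<rho> i = s \<longrightarrow> i = f"
    | (more) i j where "i < j" "\<rho> i = s" "\<rho> j = s"
    by (metis linorder_neqE_nat)
  then show ?thesis
  proof cases
    case none
    \<comment> \<open>The only candidate position is 1, and the end bound 1 excludes it.\<close>
    show ?thesis
      by (rule exI[where x=1], rule exI[where x=1], rule exI[where x=0]) (use none in auto)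
  next
    case one
    then have "\<rho> i = s \<longleftrightarrow> i = f" for i by metis
    \<comment> \<open>Period 0 shrinks the progression to the single point \<open>f\<close>.\<close>
    then have "0 \<le> length (ks_edges K) \<and>
        (\<forall>i. \<rho> i = s \<longleftrightarrow> (\<exists>k. i = f + 0 * k) \<and> ((0::nat) = 0 \<or> i < 0))"
      by simp
    then show ?thesis by blast
  next
    case more
    define f where "f = (LEAST i. \<rho> i = s)"
    have f: "\<rho> f = s" and fle: "\<rho> i = s \<Longrightarrow> f \<le> i" for i
      using more unfolding f_def by (auto intro: LeastI Least_le)
    \<comment> \<open>The unique successor from which \<open>t\<close> is reachable again, if there
      is one. From the first to the last visit to \<open>s\<close> every state lies on a cycle
      through \<open>s\<close>, so the run follows \<open>nxt\<close>.\<close>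
    define nxt where "nxt t = (SOME u. (t, u) \<in> ks_E K \<and> (u, t) \<in> (ks_E K)\<^sup>*)" for t
    have nxt: "nxt (\<rho> l) = \<rho> (Suc l)" if "f \<le> l" "l < m" "\<rho> m = s" for l m
    proof -
      have "(\<rho> (Suc l), \<rho> m) \<in> (ks_E K)\<^sup>*" "(\<rho> f, \<rho> l) \<in> (ks_E K)\<^sup>*"
        using run_reach[OF run] that by auto
      then have bck: "(\<rho> (Suc l), \<rho> l) \<in> (ks_E K)\<^sup>*" using that f by auto
      have ed: "(\<rho> l, \<rho> (Suc l)) \<in> ks_E K" using run by (simp add: is_run_def)
      show ?thesis unfolding nxt_def
        by (rule some_equality) (use ed bck flat_successor_unique[OF K] in blast)+
    qed
    have pow: "\<rho> (f + n) = (nxt ^^ n) s" if "f + n \<le> m" "\<rho> m = s" for n m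
      using that
    proof (induction n)
      case (Suc n)
      then show ?case using nxt[of "f + n" m] by simp
    qed (use f in simp)
    have ret: "\<exists>q>0. (nxt ^^ q) s = s"
      using more fle[of i] pow[of "j - f" j] by (intro exI[of _ "j - f"]) auto
    define p where "p = (LEAST q. 0 < q \<and> (nxt ^^ q) s = s)"
    have p: "0 < p" "(nxt ^^ p) s = s"
      using LeastI_ex[OF ret[unfolded Bex_def]] ret unfolding p_def by (auto intro: LeastI2_ex)
    have pmin: "\<And>q. 0 < q \<Longrightarrow> q < p \<Longrightarrow> (nxt ^^ q) s \<noteq> s"
      unfolding p_def using not_less_Least by blast
    have per: "\<rho> i = s \<longleftrightarrow> (\<exists>k. i = f + p * k)" if i: "f \<le> i" "i \<le> m" "\<rho> m = s" for i m
    proof -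
      obtain n where n: "i = f + n" using i(1) le_Suc_ex by blast
      show ?thesis
        using pow[of n m] i funpow_periodic[where f=nxt, OF p pmin, of n] unfolding n by simp
    qed
    have ex2: "\<exists>m. \<rho> m = s \<and> f < m" using more fle[of i] by force
    obtain m where m: "\<rho> m = s" "f < m" using ex2 by blast
    have pm: "f + p \<le> m" using per[of m m] m by (cases) (auto)
    \<comment> \<open>The \<open>p\<close> states of one period are distinct and each is the source
      of an edge; this bounds \<open>p\<close>.\<close>
    have inj: "inj_on (\<lambda>n. \<rho> (f + n)) {..<p}"
    proof (rule linorder_inj_onI)
      fix a b assume ab: "a < b" "a \<in> {..<p}" "b \<in> {..<p}"
      show "\<rho> (f + a) \<noteq> \<rho> (f + b)"
      proof
        assume "\<rho> (f + a) = \<rho> (f + b)"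
        then have e: "(nxt ^^ a) s = (nxt ^^ b) s" using pow[of a m] pow[of b m] ab pm m by auto
        \<comment> \<open>Completing the period from the later of two equal states would return to
          \<open>s\<close> after \<open>p - b + a < p\<close> steps.\<close>
        have "(nxt ^^ (p - b + a)) s = (nxt ^^ (p - b + b)) s"
          unfolding funpow_add comp_def e ..
        moreover have "p - b + b = p" using ab by simp
        ultimately have "(nxt ^^ (p - b + a)) s = s" by (simp only: p(2))
        moreover have "0 < p - b + a" "p - b + a < p" using ab by auto
        ultimately show False using pmin[of "p - b + a"] by (simp only:)
      qed
    qed auto
    have "(\<lambda>n. \<rho> (f + n)) ` {..<p} \<subseteq> fst ` set (ks_edges K)"
      using run by (force simp: is_run_def ks_E_def)
    from card_mono[OF _ this] have "card {..<p} \<le> card (fst ` set (ks_edges K))"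
      unfolding card_image[OF inj] by simp
    also have "\<dots> \<le> card (set (ks_edges K))" by (rule card_image_le) simp
    also have "\<dots> \<le> length (ks_edges K)" by (rule card_length)
    finally have pE: "p \<le> length (ks_edges K)" by simp
    show ?thesis
    proof (cases "finite {i. \<rho> i = s}")
      case True
      \<comment> \<open>One past the last visit, as the bound is strict.\<close>
      define g where "g = Suc (Max {i. \<rho> i = s})"
      have g1: "\<rho> (g - 1) = s" unfolding g_def using Max_in[OF True] f by auto
      have g2: "\<rho> i = s \<Longrightarrow> i < g" for i unfolding g_def using Max_ge[OF True, of i] by auto
      have "\<rho> i = s \<longleftrightarrow> (\<exists>k. i = f + p * k) \<and> (g = 0 \<or> i < g)" for i
      proof (cases "f \<le> i \<and> i < g")
        case True
        then show ?thesis using per[of i "g - 1"] g1 by auto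
      next
        case False
        then show ?thesis using g2[of i] fle[of i] by (auto simp: g_def)
      qed
      then show ?thesis using pE by blast
    next
      case False
      have "\<rho> i = s \<longleftrightarrow> (\<exists>k. i = f + p * k)" for i
      proof (cases "f \<le> i")
        case True
        obtain m where "\<rho> m = s" "i \<le> m"
          using \<open>infinite {i. \<rho> i = s}\<close> unfolding finite_nat_set_iff_bounded_le
          by (metis (mono_tags, lifting) mem_Collect_eq nat_le_linear)
        then show ?thesis using per[of i m] True by auto
      next
        case False
        then show ?thesis using fle[of i] by auto
      qed
      with pE have "p \<le> length (ks_edges K) \<and>
          (\<forall>i. \<rho> i = s \<longleftrightarrow> (\<exists>k. i = f + p * k) \<and> ((0::nat) = 0 \<or> i < 0))"
        by simp
      then show ?thesis by blast
    qed
  qed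
qed


section \<open>The formula\<close>

text \<open>Variables: the counting variable \<open>x\<close> becomes the odd number \<open>th x\<close>; the current run is given by
  three numbers \<open>blk 0 a\<close>, \<open>blk 1 a\<close>, \<open>blk 2 a\<close> per state \<open>a\<close> (first visit, end, period), a saved
  run by \<open>blk 3 a\<close>, \<open>blk 4 a\<close>, \<open>blk 5 a\<close>; auxiliary variables are even and below 64:
  \<open>vI\<close> is the position at which a formula is evaluated, \<open>vJ\<close> and \<open>vS\<close> are the position and the
  state in \<open>St\<close>, and \<open>vM - vN\<close> is the value of a term.
  The factor 128 makes the binary encoding of \<open>blk c a\<close> a fixed prefix followed by that of \<open>a\<close>.\<close>

definition th :: "nat \<Rightarrow> nat" where "th x = 2 * x + 1"
definition blk :: "nat \<Rightarrow> nat \<Rightarrow> nat" where "blk c a = 128 * a + 64 + 2 * c"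

lemma even_blk [simp]: "even (blk c a)" by (simp add: blk_def)
lemma th_eq [simp]: "th x = th y \<longleftrightarrow> x = y" by (simp add: th_def)
lemma th_neq [simp]: "even v \<Longrightarrow> th x \<noteq> v" "even v \<Longrightarrow> v \<noteq> th x"
  by (auto simp: th_def)
lemma blk_neq [simp]: "v < 64 \<Longrightarrow> blk c a \<noteq> v" "v < 64 \<Longrightarrow> v \<noteq> blk c a"
  by (auto simp: blk_def)
lemma blk_div [simp]: "c < 32 \<Longrightarrow> blk c a div 128 = a" by (simp add: blk_def)
lemma blk_eq [simp]: "c < 32 \<Longrightarrow> c' < 32 \<Longrightarrow> blk c a = blk c' a' \<longleftrightarrow> c = c' \<and> a = a'"
proof
  assume "c < 32" "c' < 32" "blk c a = blk c' a'"
  moreover from this have "a = a'" using blk_div[of c a] blk_div[of c' a'] by simp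
  ultimately show "c = c' \<and> a = a'" by (simp add: blk_def)
qed auto

abbreviation (input) vI :: nat where "vI \<equiv> 0"
abbreviation (input) vJ :: nat where "vJ \<equiv> 2"
abbreviation (input) vS :: nat where "vS \<equiv> 4"
abbreviation (input) vE :: nat where "vE \<equiv> 6"
abbreviation (input) vF :: nat where "vF \<equiv> 8"
abbreviation (input) vG :: nat where "vG \<equiv> 10"
abbreviation (input) vP :: nat where "vP \<equiv> 12"
abbreviation (input) vK :: nat where "vK \<equiv> 14"
abbreviation (input) vY :: nat where "vY \<equiv> 16"
abbreviation (input) vU :: nat where "vU \<equiv> 18"
abbreviation (input) vW :: nat where "vW \<equiv> 20"
abbreviation (input) vT :: nat where "vT \<equiv> 22"
abbreviation (input) vO :: nat where "vO \<equiv> 24"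
abbreviation (input) vQ :: nat where "vQ \<equiv> 26"
abbreviation (input) vA :: nat where "vA \<equiv> 28"
abbreviation (input) vB :: nat where "vB \<equiv> 30"
abbreviation (input) vC :: nat where "vC \<equiv> 32"
abbreviation (input) vD :: nat where "vD \<equiv> 34"
abbreviation (input) vM :: nat where "vM \<equiv> 36"
abbreviation (input) vN :: nat where "vN \<equiv> 38"

abbreviation V :: "nat \<Rightarrow> ph_term" where "V x \<equiv> PMul 1 x"

definition PFalse :: ph_form where "PFalse = PLe (PConst 1) (PConst 0)"
definition POr :: "ph_form \<Rightarrow> ph_form \<Rightarrow> ph_form" where
  "POr p q = PNot (PAnd (PNot p) (PNot q))"

text \<open>Equality with a single occurrence of the term, so that its encoding is read only once:
  exactly \<open>x\<close> numbers are smaller than \<open>t\<close>.\<close>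

definition PEq :: "nat \<Rightarrow> ph_term \<Rightarrow> ph_form" where
  "PEq x t = PCount x vE (PNot (PLe t (V vE)))"

definition PExEq :: "nat \<Rightarrow> ph_term \<Rightarrow> ph_form \<Rightarrow> ph_form" where
  "PExEq x t p = PEx x (PAnd (PEq x t) p)"

lemma sat_basic [simp]:
  "\<not> ph_sat \<eta> PFalse"
  "ph_sat \<eta> (POr p q) \<longleftrightarrow> ph_sat \<eta> p \<or> ph_sat \<eta> q"
  by (auto simp: PFalse_def POr_def)

lemma sat_PEq [simp]:
  assumes "x \<noteq> vE" "\<And>b. ph_eval (\<eta>(vE := b)) t = ph_eval \<eta> t"
  shows "ph_sat \<eta> (PEq x t) \<longleftrightarrow> \<eta> x = ph_eval \<eta> t"
proof -
  have "{b. \<not> ph_eval \<eta> t \<le> b} = {..<ph_eval \<eta> t}" by auto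
  then show ?thesis using assms by (auto simp: PEq_def)
qed

text \<open>The last assumption says that \<open>t\<close> does not read \<open>x\<close>. Hence an
  update such as that of \<open>vI\<close> to its successor must pass through a second
  variable.\<close>

lemma sat_PExEq [simp]:
  assumes "x \<noteq> vE" "\<And>\<eta> b. ph_eval (\<eta>(vE := b)) t = ph_eval \<eta> t"
    "\<And>b. ph_eval (\<eta>(x := b)) t = ph_eval \<eta> t"
  shows "ph_sat \<eta> (PExEq x t p) \<longleftrightarrow> ph_sat (\<eta>(x := ph_eval \<eta> t)) p"
  using assms by (auto simp: PExEq_def)

section \<open>Presburger description of a run\<close>

type_synonym edges = "(nat \<times> nat) list"

text \<open>The index of a variable cannot depend on the value of \<open>vS\<close>. A case
  distinction over the sources of edges copies the three numbers of that state into fixed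
  variables.\<close>

fun look :: "nat \<Rightarrow> edges \<Rightarrow> ph_form" where
  "look d [] = PFalse"
| "look d (e # E) = POr (PAnd (PEq vS (PConst (fst e))) (PAnd (PEq vF (V (blk d (fst e))))
     (PAnd (PEq vG (V (blk (Suc d) (fst e)))) (PEq vP (V (blk (Suc (Suc d)) (fst e))))))) (look d E)"

lemma sat_look: "ph_sat \<eta> (look d E) \<longleftrightarrow> \<eta> vS \<in> fst ` set E \<and> \<eta> vF = \<eta> (blk d (\<eta> vS))
    \<and> \<eta> vG = \<eta> (blk (Suc d) (\<eta> vS)) \<and> \<eta> vP = \<eta> (blk (Suc (Suc d)) (\<eta> vS))"
  by (induction E) auto

text \<open>\<open>vY = vP * vK\<close>: since the period \<open>vP\<close> is at most the number of edges, the product can be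
  unfolded along the list of edges.\<close>

fun mulF :: "edges \<Rightarrow> ph_form" where
  "mulF [] = PLe (PAdd (V vP) (V vY)) (PConst 0)"
| "mulF (e # E) = POr (PLe (PAdd (V vP) (V vY)) (PConst 0))
     (PEx vU (PAnd (PEq vP (PAdd (V vU) (PConst 1))) (PEx vW (PAnd (PEq vY (PAdd (V vW) (V vK)))
       (PExEq vP (V vU) (PExEq vY (V vW) (mulF E)))))))"

text \<open>Each edge pays for one decrement of \<open>vP\<close> and one subtraction of
  \<open>vK\<close> from \<open>vY\<close>, whence the bound on \<open>vP\<close>. A sum being at
  most 0 says that both summands are 0.\<close>

lemma sat_mulF: "ph_sat \<eta> (mulF E) \<longleftrightarrow> \<eta> vP \<le> length E \<and> \<eta> vY = \<eta> vP * \<eta> vK"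
proof (induction E arbitrary: \<eta>)
  case (Cons e E)
  show ?case by (cases "\<eta> vP") (auto simp: Cons)
qed auto

text \<open>Because \<open>look\<close> has copied the numbers of the state, the unfolded product
  occurs once and not once per state.\<close>

definition St :: "nat \<Rightarrow> edges \<Rightarrow> ph_form" where
  "St d E = PEx vF (PEx vG (PEx vP (PAnd (look d E) (PEx vK (PEx vY
     (PAnd (PEq vJ (PAdd (V vF) (V vY)))
       (PAnd (PNot (PAnd (PLe (PConst 1) (V vG)) (PLe (V vG) (V vJ)))) (mulF E))))))))"

definition visits :: "edges \<Rightarrow> (nat \<Rightarrow> nat) \<Rightarrow> nat \<Rightarrow> nat \<Rightarrow> nat \<Rightarrow> bool" where
  "visits E \<eta> d i s \<longleftrightarrow> s \<in> fst ` set E \<and> \<eta> (blk (Suc (Suc d)) s) \<le> length E \<and>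
     (\<exists>k. i = \<eta> (blk d s) + \<eta> (blk (Suc (Suc d)) s) * k) \<and>
     (\<eta> (blk (Suc d) s) = 0 \<or> i < \<eta> (blk (Suc d) s))"

lemma sat_St [simp]: "ph_sat \<eta> (St d E) \<longleftrightarrow> visits E \<eta> d (\<eta> vJ) (\<eta> vS)"
  by (auto simp: St_def sat_look sat_mulF visits_def)

lemma visits_upd [simp]:
  "v < 64 \<Longrightarrow> visits E (\<eta>(v := b)) d = visits E \<eta> d"
  "visits E (\<eta>(th x := b)) d = visits E \<eta> d"
  by (auto simp: visits_def fun_eq_iff)

definition codes :: "edges \<Rightarrow> (nat \<Rightarrow> nat) \<Rightarrow> nat \<Rightarrow> (nat \<Rightarrow> nat) \<Rightarrow> bool" where
  "codes E \<eta> d \<rho> \<longleftrightarrow> (\<forall>i s. visits E \<eta> d i s \<longleftrightarrow> \<rho> i = s)"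

fun edgeF :: "edges \<Rightarrow> ph_form" where
  "edgeF [] = PFalse"
| "edgeF (e # E) = POr (PAnd (PEq vS (PConst (fst e))) (PEq vT (PConst (snd e)))) (edgeF E)"

lemma sat_edgeF [simp]: "ph_sat \<eta> (edgeF E) \<longleftrightarrow> (\<eta> vS, \<eta> vT) \<in> set E"
  by (induction E) auto

definition initF :: "edges \<Rightarrow> nat \<Rightarrow> ph_form" where
  "initF E s = PExEq vS (PConst s) (St 0 E)"

text \<open>Counting with the value 1 turns the relation of visits into a function of the
  position.\<close>

definition validF :: "edges \<Rightarrow> nat \<Rightarrow> ph_form" where
  "validF E s = PAnd (PExEq vJ (PConst 0) (initF E s))
     (PAnd (PNot (PEx vJ (PNot (PExEq vO (PConst 1) (PCount vO vS (St 0 E))))))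
       (PNot (PEx vJ (PNot (PEx vS (PAnd (St 0 E) (PEx vT (PAnd (edgeF E)
          (PExEq vU (PAdd (V vJ) (PConst 1)) (PExEq vJ (V vU) (PExEq vS (V vT) (St 0 E))))))))))))"

lemma sat_initF [simp]: "ph_sat \<eta> (initF E s) \<longleftrightarrow> visits E \<eta> 0 (\<eta> vJ) s"
  by (simp add: initF_def)

lemma sat_validF:
  "ph_sat \<eta> (validF E s) \<longleftrightarrow>
    (\<exists>\<rho>. \<rho> 0 = s \<and> (\<forall>i. (\<rho> i, \<rho> (Suc i)) \<in> set E) \<and> codes E \<eta> 0 \<rho>)" (is "_ \<longleftrightarrow> ?R")
proof -
  let ?v = "visits E \<eta> 0"
  have "ph_sat \<eta> (validF E s) \<longleftrightarrow> ?v 0 s \<and> (\<forall>i. card {a. ?v i a} = 1)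
      \<and> (\<forall>i. \<exists>a. ?v i a \<and> (\<exists>b. (a, b) \<in> set E \<and> ?v (Suc i) b))"
    unfolding validF_def by (auto intro: card_ge_0_finite)
  also have "\<dots> \<longleftrightarrow> ?R"
  proof
    assume L: "?v 0 s \<and> (\<forall>i. card {a. ?v i a} = 1)
      \<and> (\<forall>i. \<exists>a. ?v i a \<and> (\<exists>b. (a, b) \<in> set E \<and> ?v (Suc i) b))"
    then have "\<forall>i. \<exists>b. {a. ?v i a} = {b}" by (simp add: card_1_singleton_iff)
    then obtain \<rho> where \<rho>: "\<And>i. {a. ?v i a} = {\<rho> i}" by metis
    have v: "?v i a \<longleftrightarrow> \<rho> i = a" for i a
      using \<rho>[of i] by (metis mem_Collect_eq singleton_iff)
    then show ?R using L unfolding v codes_def by blast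
  next
    assume ?R
    then obtain \<rho> where \<rho>: "\<rho> 0 = s" "\<And>i. (\<rho> i, \<rho> (Suc i)) \<in> set E" "codes E \<eta> 0 \<rho>" by blast
    then have v: "\<And>i a. ?v i a \<longleftrightarrow> \<rho> i = a" by (simp add: codes_def)
    show "?v 0 s \<and> (\<forall>i. card {a. ?v i a} = 1)
      \<and> (\<forall>i. \<exists>a. ?v i a \<and> (\<exists>b. (a, b) \<in> set E \<and> ?v (Suc i) b))"
      unfolding v using \<rho> by auto
  qed
  finally show ?thesis .
qed

text \<open>Inclusion in one direction suffices: when both groups of numbers code runs, each names
  exactly one state per position.\<close>

definition agreeF :: "edges \<Rightarrow> ph_form" where
  "agreeF E = PNot (PEx vJ (PAnd (PLe (V vJ) (V vI)) (PEx vS (PAnd (St 0 E) (PNot (St 3 E))))))"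

lemma sat_agreeF: "ph_sat \<eta> (agreeF E) \<longleftrightarrow> (\<forall>j\<le>\<eta> vI. \<forall>s. visits E \<eta> 0 j s \<longrightarrow> visits E \<eta> 3 j s)"
  by (auto simp: agreeF_def)

section \<open>Quantifying over runs and saving the current one\<close>

fun exz :: "edges \<Rightarrow> ph_form \<Rightarrow> ph_form" where
  "exz [] p = p"
| "exz (e # E) p = PEx (blk 0 (fst e)) (PEx (blk 1 (fst e)) (PEx (blk 2 (fst e)) (exz E p)))"

definition off :: "edges \<Rightarrow> nat \<Rightarrow> nat set" where
  "off E d = {v. \<forall>a\<in>fst ` set E. v \<noteq> blk d a \<and> v \<noteq> blk (d+1) a \<and> v \<noteq> blk (d+2) a}"

text \<open>A state with several outgoing edges is quantified repeatedly, which changes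
  nothing.\<close>

lemma sat_exz: "ph_sat \<eta> (exz E p) \<longleftrightarrow> (\<exists>\<eta>'. (\<forall>v\<in>off E 0. \<eta>' v = \<eta> v) \<and> ph_sat \<eta>' p)"
proof (induction E arbitrary: \<eta>)
  case Nil
  have "(\<forall>v\<in>off [] 0. \<eta>' v = \<eta> v) \<longleftrightarrow> \<eta>' = \<eta>" for \<eta>' by (auto simp: off_def)
  then show ?case by simp
next
  case (Cons e E)
  let ?u = "\<lambda>x y z. \<eta>(blk 0 (fst e) := x, blk 1 (fst e) := y, blk 2 (fst e) := z)"
  have *: "(\<exists>x y z. \<forall>v\<in>off E 0. \<eta>' v = ?u x y z v) \<longleftrightarrow> (\<forall>v\<in>off (e # E) 0. \<eta>' v = \<eta> v)" for \<eta>'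
  proof
    assume "\<exists>x y z. \<forall>v\<in>off E 0. \<eta>' v = ?u x y z v"
    then show "\<forall>v\<in>off (e # E) 0. \<eta>' v = \<eta> v" by (auto simp: off_def)
  next
    assume "\<forall>v\<in>off (e # E) 0. \<eta>' v = \<eta> v"
    then show "\<exists>x y z. \<forall>v\<in>off E 0. \<eta>' v = ?u x y z v"
      by (intro exI[of _ "\<eta>' (blk 0 (fst e))"] exI[of _ "\<eta>' (blk 1 (fst e))"]
          exI[of _ "\<eta>' (blk 2 (fst e))"]) (auto simp: off_def)
  qed
  have "ph_sat \<eta> (exz (e # E) p) \<longleftrightarrow>
      (\<exists>\<eta>'. (\<exists>x y z. \<forall>v\<in>off E 0. \<eta>' v = ?u x y z v) \<and> ph_sat \<eta>' p)"
    unfolding exz.simps ph_sat.simps Cons by blast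
  then show ?case unfolding * .
qed

text \<open>One saved copy serves all nested path quantifiers: it is read only in
  \<open>agreeF\<close>, outside the translated subformula, so an inner quantifier may overwrite
  it.\<close>

fun sav :: "edges \<Rightarrow> ph_form \<Rightarrow> ph_form" where
  "sav [] p = p"
| "sav (e # E) p = PExEq (blk 3 (fst e)) (V (blk 0 (fst e)))
     (PExEq (blk 4 (fst e)) (V (blk 1 (fst e))) (PExEq (blk 5 (fst e)) (V (blk 2 (fst e))) (sav E p)))"

lemma sat_sav: "\<exists>\<eta>'. ph_sat \<eta> (sav E p) = ph_sat \<eta>' p \<and> (\<forall>v\<in>off E 3. \<eta>' v = \<eta> v)
    \<and> (\<forall>a\<in>fst ` set E. \<eta>' (blk 3 a) = \<eta> (blk 0 a) \<and> \<eta>' (blk 4 a) = \<eta> (blk 1 a) \<and> \<eta>' (blk 5 a) = \<eta> (blk 2 a))"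
proof (induction E arbitrary: \<eta>)
  case Nil
  show ?case by (rule exI[of _ \<eta>]) simp
next
  case (Cons e E)
  let ?a = "fst e"
  let ?\<eta> = "\<eta>(blk 3 ?a := \<eta> (blk 0 ?a), blk 4 ?a := \<eta> (blk 1 ?a), blk 5 ?a := \<eta> (blk 2 ?a))"
  obtain \<eta>' where \<eta>': "ph_sat ?\<eta> (sav E p) = ph_sat \<eta>' p" "\<And>v. v \<in> off E 3 \<Longrightarrow> \<eta>' v = ?\<eta> v"
    "\<And>a. a \<in> fst ` set E \<Longrightarrow> \<eta>' (blk 3 a) = ?\<eta> (blk 0 a) \<and> \<eta>' (blk 4 a) = ?\<eta> (blk 1 a) \<and> \<eta>' (blk 5 a) = ?\<eta> (blk 2 a)"
    using Cons.IH[of ?\<eta>] by blast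
  \<comment> \<open>A later edge with the same source copies the same numbers again.\<close>
  have a: "\<eta>' (blk 3 ?a) = \<eta> (blk 0 ?a) \<and> \<eta>' (blk 4 ?a) = \<eta> (blk 1 ?a) \<and> \<eta>' (blk 5 ?a) = \<eta> (blk 2 ?a)"
  proof (cases "?a \<in> fst ` set E")
    case False
    then have "blk 3 ?a \<in> off E 3" "blk 4 ?a \<in> off E 3" "blk 5 ?a \<in> off E 3"
      by (auto simp: off_def)
    then show ?thesis by (simp add: \<eta>'(2))
  qed (use \<eta>'(3) in simp)
  have o: "\<eta>' v = \<eta> v" if "v \<in> off (e # E) 3" for v
  proof -
    have "v \<in> off E 3" "v \<noteq> blk 3 ?a" "v \<noteq> blk 4 ?a" "v \<noteq> blk 5 ?a"
      using that by (auto simp: off_def)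
    then show ?thesis by (simp add: \<eta>'(2))
  qed
  have "ph_sat \<eta> (sav (e # E) p) = ph_sat \<eta>' p" using \<eta>'(1) by simp
  moreover have "\<forall>b\<in>fst ` set (e # E). \<eta>' (blk 3 b) = \<eta> (blk 0 b) \<and> \<eta>' (blk 4 b) = \<eta> (blk 1 b)
      \<and> \<eta>' (blk 5 b) = \<eta> (blk 2 b)"
    using a \<eta>'(3) by auto
  ultimately show ?case using o by blast
qed

text \<open>The proposition is a variable, so that this text depends on the structure alone; the
  constant is compared afterwards, when the formula is being read.\<close>

fun memF :: "nat list \<Rightarrow> ph_form" where
  "memF [] = PFalse"
| "memF (q # l) = POr (PEq vQ (PConst q)) (memF l)"

text \<open>The list of label sets carries no state numbers. The state is found by counting
  \<open>vS\<close> down along the list.\<close>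

fun labF :: "nat list list \<Rightarrow> ph_form" where
  "labF [] = PFalse"
| "labF (l # ls) = POr (PAnd (PEq vS (PConst 0)) (memF l))
     (PEx vU (PAnd (PEq vS (PAdd (V vU) (PConst 1))) (PExEq vS (V vU) (labF ls))))"

lemma sat_memF [simp]: "ph_sat \<eta> (memF l) \<longleftrightarrow> \<eta> vQ \<in> set l"
  by (induction l) auto

lemma sat_labF [simp]: "ph_sat \<eta> (labF ls) \<longleftrightarrow> \<eta> vS < length ls \<and> \<eta> vQ \<in> set (ls ! \<eta> vS)"
proof (induction ls arbitrary: \<eta>)
  case (Cons l ls)
  show ?case by (cases "\<eta> vS") (auto simp: Cons)
qed auto

text \<open>\<open>tr K \<phi>\<close> says that \<open>\<phi>\<close> holds at position \<open>vI\<close> of the current run, \<open>trv K t\<close> that \<open>t\<close> has the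
  value \<open>vM - vN\<close>. Auxiliary variables are requantified, so that the translation of a formula
  is a prefix followed by the translations of its immediate subformulas.\<close>

fun tr :: "kripke \<Rightarrow> cform \<Rightarrow> ph_form" and trv :: "kripke \<Rightarrow> cterm \<Rightarrow> ph_form" where
  "tr K (CAP p) = PExEq vJ (V vI) (PEx vS (PAnd (St 0 (ks_edges K))
     (PEx vQ (PAnd (labF (ks_labels K)) (PEq vQ (PConst p))))))"
| "tr K (CAnd f g) = PAnd (tr K f) (tr K g)"
| "tr K (CNot f) = PNot (tr K f)"
| "tr K (CX f) = PExEq vJ (PAdd (V vI) (PConst 1)) (PExEq vI (V vJ) (tr K f))"
| "tr K (CU f g) = PExEq vO (V vI) (PEx vI (PAnd (PLe (V vO) (V vI))
     (PAnd (PNot (PEx vJ (PAnd (PLe (V vO) (V vJ)) (PAnd (PLe (PAdd (V vJ) (PConst 1)) (V vI))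
        (PNot (PExEq vI (V vJ) (tr K f)))))))
       (tr K g))))"
| "tr K (CE f) = sav (ks_edges K) (exz (ks_edges K) (PAnd (validF (ks_edges K) (ks_init K))
     (PAnd (agreeF (ks_edges K)) (tr K f))))"
| "tr K (CBind x f) = PExEq (th x) (V vI) (tr K f)"
| "tr K (CLe s t) = PEx vA (PEx vB (PEx vM (PEx vN (PAnd (PLe (PAdd (V vA) (V vN)) (PAdd (V vM) (V vB)))
     (PAnd (PExEq vM (V vA) (PExEq vN (V vB) (trv K s))) (trv K t))))))"
| "trv K (CConst a) = (if 0 \<le> a then PEq vM (PAdd (V vN) (PConst (nat \<bar>a\<bar>)))
     else PEq vN (PAdd (V vM) (PConst (nat \<bar>a\<bar>))))"
| "trv K (CCount a x f) = PEx vC (PAnd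
     (if 0 \<le> a then PEq vM (PAdd (V vN) (PMul (nat \<bar>a\<bar>) vC)) else PEq vN (PAdd (V vM) (PMul (nat \<bar>a\<bar>) vC)))
     (PCount vC vJ (PAnd (PLe (V (th x)) (V vJ)) (PAnd (PLe (V vJ) (V vI)) (PExEq vI (V vJ) (tr K f))))))"
| "trv K (CAdd s t) = PEx vA (PEx vB (PEx vC (PEx vD
     (PAnd (PLe (PAdd (V vM) (PAdd (V vB) (V vD))) (PAdd (V vN) (PAdd (V vA) (V vC))))
     (PAnd (PLe (PAdd (V vN) (PAdd (V vA) (V vC))) (PAdd (V vM) (PAdd (V vB) (V vD))))
     (PExEq vM (V vC) (PExEq vN (V vD)
       (PAnd (PExEq vM (V vA) (PExEq vN (V vB) (trv K s))) (trv K t)))))))))"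

text \<open>Besides the variables these are the propositions and coefficients, which a scan does not tell
  apart from variables; it is harmless to require that further variables are 0.\<close>

fun toks :: "cform \<Rightarrow> nat list" and tokt :: "cterm \<Rightarrow> nat list" where
  "toks (CAP p) = [p]"
| "toks (CAnd f g) = toks f @ toks g"
| "toks (CNot f) = toks f"
| "toks (CX f) = toks f"
| "toks (CU f g) = toks f @ toks g"
| "toks (CE f) = toks f"
| "toks (CBind x f) = x # toks f"
| "toks (CLe s t) = tokt s @ tokt t"
| "tokt (CConst a) = [nat \<bar>a\<bar>]"
| "tokt (CCount a x f) = nat \<bar>a\<bar> # x # toks f"
| "tokt (CAdd s t) = tokt s @ tokt t"

fun zeroF :: "nat list \<Rightarrow> ph_form \<Rightarrow> ph_form" where
  "zeroF [] p = p"
| "zeroF (x # xs) p = PAnd (PLe (V (th x)) (PConst 0)) (zeroF xs p)"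

lemma sat_zeroF [simp]: "ph_sat \<eta> (zeroF xs p) \<longleftrightarrow> (\<forall>x\<in>set xs. \<eta> (th x) = 0) \<and> ph_sat \<eta> p"
  by (induction xs) auto

text \<open>A formula is evaluated with all counting variables 0, whereas satisfiability leaves free
  variables open; \<open>zeroF\<close> closes this gap. The position is quantified because
  \<open>models\<close> allows any visit to the initial state, not only position 0.\<close>

definition red :: "kripke \<Rightarrow> cform \<Rightarrow> ph_form" where
  "red K f = zeroF (toks f) (exz (ks_edges K) (PAnd (validF (ks_edges K) (ks_init K))
     (PEx vI (PAnd (PExEq vJ (V vI) (initF (ks_edges K) (ks_init K))) (tr K f)))))"

section \<open>Correctness of the translation\<close>

lemma in_off [simp]: "v < 64 \<Longrightarrow> v \<in> off E d" "th x \<in> off E d"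
  by (auto simp: off_def)

lemma is_run_edges: "is_run K \<rho> \<longleftrightarrow> \<rho> 0 = ks_init K \<and> (\<forall>i. (\<rho> i, \<rho> (Suc i)) \<in> set (ks_edges K))"
  by (simp add: is_run_def ks_E_def)

text \<open>This is where flatness enters: every run has a numerical description, reachable by
  changing only the current group of numbers.\<close>

lemma run_coded:
  assumes "FKS K" "is_run K \<rho>"
  shows "\<exists>\<eta>'. (\<forall>v\<in>off (ks_edges K) 0. \<eta>' v = \<eta> v) \<and> codes (ks_edges K) \<eta>' 0 \<rho>"
proof -
  let ?E = "ks_edges K" and ?A = "fst ` set (ks_edges K)"
  obtain F G P where v: "\<And>s. P s \<le> length ?E \<and>
    (\<forall>i. \<rho> i = s \<longleftrightarrow> (\<exists>k. i = F s + P s * k) \<and> (G s = 0 \<or> i < G s))"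
    using flat_run_visits[OF assms] by metis
  \<comment> \<open>Division by 128 recovers the state to which a variable of a block
    belongs.\<close>
  define \<eta>' where "\<eta>' v = (let a = v div 128 in if a \<notin> ?A then \<eta> v else if v = blk 0 a then F a
    else if v = blk 1 a then G a else if v = blk 2 a then P a else \<eta> v)" for v
  have "\<eta>' v = \<eta> v" if "v \<in> off ?E 0" for v
    using that by (auto simp: \<eta>'_def Let_def off_def)
  moreover have "codes ?E \<eta>' 0 \<rho>" unfolding codes_def
  proof (intro allI)
    fix i s
    have "\<rho> i \<in> ?A" using assms(2) by (force simp: is_run_edges)
    moreover have "visits ?E \<eta>' 0 i s \<longleftrightarrow> \<rho> i = s" if "s \<in> ?A"
      using v[of s] that by (simp add: visits_def \<eta>'_def)
    ultimately show "visits ?E \<eta>' 0 i s \<longleftrightarrow> \<rho> i = s"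
      by (metis visits_def)
  qed
  ultimately show ?thesis by blast
qed

lemma codes_upd [simp]:
  "v < 64 \<Longrightarrow> codes E (\<eta>(v := b)) d = codes E \<eta> d"
  "codes E (\<eta>(th x := b)) d = codes E \<eta> d"
  by (auto simp: codes_def fun_eq_iff)

lemma visits_cong:
  assumes "\<And>s. s \<in> fst ` set E \<Longrightarrow> \<eta>' (blk d' s) = \<eta> (blk d s) \<and> \<eta>' (blk (Suc d') s) = \<eta> (blk (Suc d) s)
    \<and> \<eta>' (blk (Suc (Suc d')) s) = \<eta> (blk (Suc (Suc d)) s)"
  shows "visits E \<eta>' d' i s = visits E \<eta> d i s"
proof (cases "s \<in> fst ` set E")
  case True
  then show ?thesis using assms[of s] unfolding visits_def by simp
next
  case False
  then show ?thesis unfolding visits_def by blast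
qed

text \<open>With the subformula abstracted to \<open>p\<close> and its meaning to \<open>Q\<close>,
  only the interplay of the two runs remains.\<close>

lemma sat_CE:
  assumes K: "FKS K" and c: "codes (ks_edges K) \<eta> 0 \<rho>" and i: "\<eta> vI = i"
    and p: "\<And>\<eta>' \<rho>'. codes (ks_edges K) \<eta>' 0 \<rho>' \<Longrightarrow> is_run K \<rho>' \<Longrightarrow> \<eta>' vI = i \<Longrightarrow>
      (\<And>x. \<eta>' (th x) = \<eta> (th x)) \<Longrightarrow> ph_sat \<eta>' p \<longleftrightarrow> Q \<rho>'"
  shows "ph_sat \<eta> (sav (ks_edges K) (exz (ks_edges K) (PAnd (validF (ks_edges K) (ks_init K))
     (PAnd (agreeF (ks_edges K)) p)))) \<longleftrightarrow> (\<exists>\<rho>'. is_run K \<rho>' \<and> (\<forall>j\<le>i. \<rho>' j = \<rho> j) \<and> Q \<rho>')"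
proof -
  let ?E = "ks_edges K"
  let ?p = "exz ?E (PAnd (validF ?E (ks_init K)) (PAnd (agreeF ?E) p))"
  obtain \<eta>1 where s: "ph_sat \<eta> (sav ?E ?p) = ph_sat \<eta>1 ?p"
    and o: "\<And>v. v \<in> off ?E 3 \<Longrightarrow> \<eta>1 v = \<eta> v"
    and sv: "\<And>a. a \<in> fst ` set ?E \<Longrightarrow> \<eta>1 (blk 3 a) = \<eta> (blk 0 a) \<and> \<eta>1 (blk 4 a) = \<eta> (blk 1 a) \<and> \<eta>1 (blk 5 a) = \<eta> (blk 2 a)"
    using sat_sav[of \<eta> ?E ?p] by blast
  have agree: "ph_sat \<eta>2 (agreeF ?E) \<longleftrightarrow> (\<forall>j\<le>i. \<rho>' j = \<rho> j)" and i2: "\<eta>2 vI = i"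
    and th2: "\<And>x. \<eta>2 (th x) = \<eta> (th x)"
    if o2: "\<forall>v\<in>off ?E 0. \<eta>2 v = \<eta>1 v" and c2: "codes ?E \<eta>2 0 \<rho>'" for \<eta>2 \<rho>'
  proof -
    show i2: "\<eta>2 vI = i" using o2 o i by simp
    show "\<And>x. \<eta>2 (th x) = \<eta> (th x)" using o2 o by simp
    \<comment> \<open>Requantifying touches blocks 0 to 2 only, so blocks 3 to 5 still describe
      \<rho>.\<close>
    have "visits ?E \<eta>2 3 j s = visits ?E \<eta> 0 j s" for j s
    proof (rule visits_cong)
      fix a assume a: "a \<in> fst ` set ?E"
      have "blk 3 a \<in> off ?E 0" "blk 4 a \<in> off ?E 0" "blk 5 a \<in> off ?E 0"
        by (auto simp: off_def)
      then show "\<eta>2 (blk 3 a) = \<eta> (blk 0 a) \<and> \<eta>2 (blk (Suc 3) a) = \<eta> (blk (Suc 0) a) \<and>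
          \<eta>2 (blk (Suc (Suc 3)) a) = \<eta> (blk (Suc (Suc 0)) a)"
        using o2 sv[OF a] by (simp add: eval_nat_numeral)
    qed
    then show "ph_sat \<eta>2 (agreeF ?E) \<longleftrightarrow> (\<forall>j\<le>i. \<rho>' j = \<rho> j)"
      using c c2 i2 unfolding sat_agreeF codes_def by simp metis
  qed
  have "ph_sat \<eta>1 ?p \<longleftrightarrow> (\<exists>\<eta>2. (\<forall>v\<in>off ?E 0. \<eta>2 v = \<eta>1 v) \<and>
     (\<exists>\<rho>'. is_run K \<rho>' \<and> codes ?E \<eta>2 0 \<rho>') \<and> ph_sat \<eta>2 (agreeF ?E) \<and> ph_sat \<eta>2 p)"
    by (simp add: sat_exz sat_validF is_run_edges conj_assoc)
  also have "\<dots> \<longleftrightarrow> (\<exists>\<rho>'. is_run K \<rho>' \<and> (\<forall>j\<le>i. \<rho>' j = \<rho> j) \<and> Q \<rho>')" (is "?L \<longleftrightarrow> ?R")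
  proof
    assume ?L
    then show ?R using agree i2 th2 p by metis
  next
    assume ?R
    then obtain \<rho>' where r: "is_run K \<rho>'" "\<forall>j\<le>i. \<rho>' j = \<rho> j" "Q \<rho>'" by blast
    obtain \<eta>2 where e: "\<forall>v\<in>off ?E 0. \<eta>2 v = \<eta>1 v" "codes ?E \<eta>2 0 \<rho>'"
      using run_coded[OF K r(1)] by blast
    have "ph_sat \<eta>2 (agreeF ?E)" using agree[OF e] r(2) by blast
    moreover have "ph_sat \<eta>2 p" using p[OF e(2) r(1) i2[OF e] th2[OF e]] r(3) by blast
    ultimately show ?L using e r by blast
  qed
  finally show ?thesis using s by simp
qed

text \<open>The valuations need to agree only on \<open>toks f\<close>, which are the variables that
  \<open>zeroF\<close> can force to 0.\<close>

lemma tr_correct: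
  assumes K: "FKS K"
  shows "is_run K \<rho> \<Longrightarrow> codes (ks_edges K) \<eta> 0 \<rho> \<Longrightarrow> \<eta> vI = i \<Longrightarrow>
      (\<And>x. x \<in> set (toks f) \<Longrightarrow> \<eta> (th x) = \<theta> x) \<Longrightarrow> ph_sat \<eta> (tr K f) \<longleftrightarrow> csat K \<rho> i \<theta> f"
    and "is_run K \<rho> \<Longrightarrow> codes (ks_edges K) \<eta> 0 \<rho> \<Longrightarrow> \<eta> vI = i \<Longrightarrow>
      (\<And>x. x \<in> set (tokt t) \<Longrightarrow> \<eta> (th x) = \<theta> x) \<Longrightarrow>
      ph_sat \<eta> (trv K t) \<longleftrightarrow> int (\<eta> vM) - int (\<eta> vN) = cval K \<rho> i \<theta> t"
proof (induction f and t arbitrary: \<rho> \<eta> i \<theta> and \<rho> \<eta> i \<theta>)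
  case (CAP p)
  have "\<rho> i \<in> ks_states K" using CAP(1) K unfolding is_run_def FKS_def ks_wf_def by blast
  then have "\<rho> i < length (ks_labels K)" using K by (auto simp: FKS_def ks_wf_def ks_states_def)
  then show ?case using CAP(2,3) by (simp add: codes_def ks_lab_def)
next
  case (CE f)
  show ?case unfolding tr.simps csat.simps
    by (rule sat_CE[OF K CE.prems(2,3)]) (use CE.IH CE.prems(4) in auto)
next
  case (CLe s t)
  have s: "ph_sat (\<eta>(vA := a, vB := b, vM := m, vN := n, vM := a, vN := b)) (trv K s)
      \<longleftrightarrow> int a - int b = cval K \<rho> i \<theta> s" for a b m n
    using CLe.prems by (subst CLe.IH(1)[where i=i and \<rho>=\<rho> and \<theta>=\<theta>]) auto
  have t: "ph_sat (\<eta>(vA := a, vB := b, vM := m, vN := n)) (trv K t)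
      \<longleftrightarrow> int m - int n = cval K \<rho> i \<theta> t" for a b m n
    using CLe.prems by (subst CLe.IH(2)[where i=i and \<rho>=\<rho> and \<theta>=\<theta>]) auto
  \<comment> \<open>Every integer is a difference of natural numbers, namely of its positive and its
    negative part.\<close>
  have ex: "\<exists>a b. int a - int b = z" for z
    by (rule exI[of _ "nat z"], rule exI[of _ "nat (- z)"]) simp
  have "ph_sat \<eta> (tr K (CLe s t)) \<longleftrightarrow> (\<exists>a b m n. a + n \<le> m + b \<and>
      int a - int b = cval K \<rho> i \<theta> s \<and> int m - int n = cval K \<rho> i \<theta> t)"
    using s t by simp
  also have "\<dots> \<longleftrightarrow> cval K \<rho> i \<theta> s \<le> cval K \<rho> i \<theta> t"
  proof
    obtain a b where "int a - int b = cval K \<rho> i \<theta> s" using ex by blast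
    moreover obtain m n where "int m - int n = cval K \<rho> i \<theta> t" using ex by blast
    moreover assume "cval K \<rho> i \<theta> s \<le> cval K \<rho> i \<theta> t"
    ultimately have "a + n \<le> m + b" by linarith
    with \<open>int a - int b = _\<close> \<open>int m - int n = _\<close>
    show "\<exists>a b m n. a + n \<le> m + b \<and>
      int a - int b = cval K \<rho> i \<theta> s \<and> int m - int n = cval K \<rho> i \<theta> t" by blast
  qed force
  finally show ?case by simp
next
  case (CAdd s t)
  have s: "ph_sat (\<eta>(vA := a, vB := b, vC := c, vD := d, vM := c, vN := d, vM := a, vN := b)) (trv K s)
      \<longleftrightarrow> int a - int b = cval K \<rho> i \<theta> s" for a b c d
    using CAdd.prems by (subst CAdd.IH(1)[where i=i and \<rho>=\<rho> and \<theta>=\<theta>]) auto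
  have t: "ph_sat (\<eta>(vA := a, vB := b, vC := c, vD := d, vM := c, vN := d)) (trv K t)
      \<longleftrightarrow> int c - int d = cval K \<rho> i \<theta> t" for a b c d
    using CAdd.prems by (subst CAdd.IH(2)[where i=i and \<rho>=\<rho> and \<theta>=\<theta>]) auto
  have ex: "\<exists>a b. int a - int b = z" for z
    by (rule exI[of _ "nat z"], rule exI[of _ "nat (- z)"]) simp
  have "ph_sat \<eta> (trv K (CAdd s t)) \<longleftrightarrow> (\<exists>a b c d. \<eta> vM + (b + d) \<le> \<eta> vN + (a + c) \<and>
      \<eta> vN + (a + c) \<le> \<eta> vM + (b + d) \<and>
      int a - int b = cval K \<rho> i \<theta> s \<and> int c - int d = cval K \<rho> i \<theta> t)"
    using s t by simp
  also have "\<dots> \<longleftrightarrow> int (\<eta> vM) - int (\<eta> vN) = cval K \<rho> i \<theta> s + cval K \<rho> i \<theta> t"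
  proof
    obtain a b where "int a - int b = cval K \<rho> i \<theta> s" using ex by blast
    moreover obtain m n where "int m - int n = cval K \<rho> i \<theta> t" using ex by blast
    moreover assume "int (\<eta> vM) - int (\<eta> vN) = cval K \<rho> i \<theta> s + cval K \<rho> i \<theta> t"
    ultimately have "\<eta> vM + (b + n) \<le> \<eta> vN + (a + m)" "\<eta> vN + (a + m) \<le> \<eta> vM + (b + n)"
      by linarith+
    with \<open>int a - int b = _\<close> \<open>int m - int n = _\<close>
    show "\<exists>a b c d. \<eta> vM + (b + d) \<le> \<eta> vN + (a + c) \<and> \<eta> vN + (a + c) \<le> \<eta> vM + (b + d) \<and>
      int a - int b = cval K \<rho> i \<theta> s \<and> int c - int d = cval K \<rho> i \<theta> t" by blast
  qed force
  finally show ?case by simp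
next
  case (CCount a x f)
  have f: "ph_sat (\<eta>(vC := c, vJ := j, vI := j)) (tr K f) \<longleftrightarrow> csat K \<rho> j \<theta> f" for c j
    using CCount.prems by (subst CCount.IH[where i=j and \<rho>=\<rho> and \<theta>=\<theta>]) auto
  have x: "\<eta> (th x) = \<theta> x" using CCount.prems(4) by simp
  \<comment> \<open>The counting quantifier is false on infinite sets; here positions are bounded by
    \<open>i\<close>.\<close>
  have fin: "finite {j. \<theta> x \<le> j \<and> j \<le> i \<and> csat K \<rho> j \<theta> f}" by (rule finite_subset[of _ "{..i}"]) auto
  \<comment> \<open>Coefficients in PH are natural, so the sign of \<open>a\<close> decides to which
    side of the equation the product goes.\<close>
  have pos: "m = n + nat a * c \<longleftrightarrow> int m - int n = a * int c" if "0 \<le> a" for m n c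
  proof -
    have "int (n + nat a * c) = int n + a * int c" using that by simp
    then show ?thesis by linarith
  qed
  have neg: "n = m + nat (- a) * c \<longleftrightarrow> int m - int n = a * int c" if "\<not> 0 \<le> a" for m n c
  proof -
    have "int (m + nat (- a) * c) = int m - a * int c" using that by simp
    then show ?thesis by linarith
  qed
  show ?case using CCount.prems(3) f x fin by (auto simp: pos neg)
next
  case (CU f g)
  have f: "ph_sat (\<eta>(vO := i, vI := k, vJ := j, vI := j)) (tr K f) \<longleftrightarrow> csat K \<rho> j \<theta> f" for k j
    using CU.prems by (subst CU.IH(1)[where i=j and \<rho>=\<rho> and \<theta>=\<theta>]) auto
  have g: "ph_sat (\<eta>(vO := i, vI := k)) (tr K g) \<longleftrightarrow> csat K \<rho> k \<theta> g" for k
    using CU.prems by (subst CU.IH(2)[where i=k and \<rho>=\<rho> and \<theta>=\<theta>]) auto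
  show ?case using CU.prems(3) f g by (auto simp: Suc_le_eq)
next
  case (CX f)
  show ?case using CX.prems by (simp, subst CX.IH[where i="Suc i" and \<rho>=\<rho> and \<theta>=\<theta>]) auto
next
  case (CBind x f)
  show ?case using CBind.prems
    by (simp, subst CBind.IH[where i=i and \<rho>=\<rho> and \<theta>="\<theta>(x := i)"]) auto
qed auto

theorem red_correct:
  assumes K: "FKS K"
  shows "ph_satisfiable (red K f) \<longleftrightarrow> models K f"
proof
  let ?E = "ks_edges K"
  assume "ph_satisfiable (red K f)"
  then obtain \<eta>0 \<eta> \<rho> i where z: "\<forall>x\<in>set (toks f). \<eta>0 (th x) = 0"
    and o: "\<forall>v\<in>off ?E 0. \<eta> v = \<eta>0 v" and r: "is_run K \<rho>" "codes ?E \<eta> 0 \<rho>"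
    and i: "visits ?E \<eta> 0 i (ks_init K)" and s: "ph_sat (\<eta>(vI := i)) (tr K f)"
    unfolding ph_satisfiable_def red_def
    by (auto simp: sat_exz sat_validF is_run_edges)
  have "csat K \<rho> i (\<lambda>_. 0) f"
    using s by (subst (asm) tr_correct(1)[OF K r(1), where i=i and \<theta>="\<lambda>_. 0"]) (use r z o in auto)
  moreover have "\<rho> i = ks_init K" using r(2) i by (simp add: codes_def)
  ultimately show "models K f" using r(1) by (auto simp: models_def state_sat_def)
next
  let ?E = "ks_edges K"
  assume "models K f"
  then obtain \<rho> i where r: "is_run K \<rho>" "\<rho> i = ks_init K" "csat K \<rho> i (\<lambda>_. 0) f"
    by (auto simp: models_def state_sat_def)
  obtain \<eta> where e: "\<forall>v\<in>off ?E 0. \<eta> v = 0" "codes ?E \<eta> 0 \<rho>"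
    using run_coded[OF K r(1), of "\<lambda>_. 0"] by blast
  have s: "ph_sat (\<eta>(vI := i)) (tr K f)"
    using r(3) by (subst tr_correct(1)[OF K r(1), where i=i and \<theta>="\<lambda>_. 0"]) (use e in auto)
  moreover have "visits ?E \<eta> 0 i (ks_init K)" using e(2) r(2) by (simp add: codes_def)
  moreover have "ph_sat \<eta> (validF ?E (ks_init K))" using e(2) r(1) by (auto simp: sat_validF is_run_edges)
  ultimately have "ph_sat \<eta> (PAnd (validF ?E (ks_init K))
     (PEx vI (PAnd (PExEq vJ (V vI) (initF ?E (ks_init K))) (tr K f))))" by auto
  then have "ph_sat (\<lambda>_. 0) (red K f)" unfolding red_def using e(1) by (auto simp: sat_exz)
  then show "ph_satisfiable (red K f)" unfolding ph_satisfiable_def by blast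
qed


section \<open>A structured language for two-way one-pebble transducers\<close>

datatype act = MvR | MvL | SetP | ClrP | Out nat

text \<open>A test sees the scanned symbol (0 beyond the input), whether the pebble lies on it,
  and whether the head is at the left end.\<close>

datatype com =
    Nop
  | Do act
  | Seq com com
  | Cond "nat \<Rightarrow> bool \<Rightarrow> bool \<Rightarrow> bool" com com
  | Loop "nat \<Rightarrow> bool \<Rightarrow> bool \<Rightarrow> bool" com

text \<open>A tape is a zipper: the reversed part left of the head, the part starting at the head,
  and the position of the pebble.\<close>

type_synonym tape = "nat list \<times> nat list \<times> nat option"

definition rd :: "nat list \<Rightarrow> nat \<Rightarrow> nat" where
  "rd w x = (if x < length w then w ! x else 0)"

definition test :: "(nat \<Rightarrow> bool \<Rightarrow> bool \<Rightarrow> bool) \<Rightarrow> tape \<Rightarrow> bool" where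
  "test b s = (case s of (u, v, p) \<Rightarrow> b (rd v 0) (p = Some (length u)) (u = []))"

text \<open>Moving beyond the input and dropping a second pebble fail, which keeps the number of
  configurations finite. At the left end \<open>MvL\<close> stays, as the Turing machine
  does.\<close>

fun act_step :: "act \<Rightarrow> tape \<Rightarrow> (nat list \<times> tape) option" where
  "act_step MvR (u, v, p) = (case v of [] \<Rightarrow> None | x # v \<Rightarrow> Some ([], x # u, v, p))"
| "act_step MvL (u, v, p) = Some ([], case u of [] \<Rightarrow> ([], v, p) | x # u \<Rightarrow> (u, x # v, p))"
| "act_step SetP (u, v, p) = (if p = None then Some ([], u, v, Some (length u)) else None)"
| "act_step ClrP (u, v, p) = (if p = Some (length u) then Some ([], u, v, None) else None)"
| "act_step (Out f) s = (if 0 < f \<and> f < 27 then Some ([f], s) else None)"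

inductive ex :: "com \<Rightarrow> tape \<Rightarrow> nat list \<Rightarrow> tape \<Rightarrow> bool" where
  ex_Nop: "ex Nop s [] s"
| ex_Do: "act_step a s = Some (out, s') \<Longrightarrow> ex (Do a) s out s'"
| ex_Seq: "ex c s o1 s' \<Longrightarrow> ex d s' o2 s'' \<Longrightarrow> ex (Seq c d) s (o1 @ o2) s''"
| ex_CondT: "test b s \<Longrightarrow> ex c s out s' \<Longrightarrow> ex (Cond b c d) s out s'"
| ex_CondF: "\<not> test b s \<Longrightarrow> ex d s out s' \<Longrightarrow> ex (Cond b c d) s out s'"
| ex_LoopF: "\<not> test b s \<Longrightarrow> ex (Loop b c) s [] s"
| ex_LoopT: "test b s \<Longrightarrow> ex c s o1 s' \<Longrightarrow> ex (Loop b c) s' o2 s''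
    \<Longrightarrow> ex (Loop b c) s (o1 @ o2) s''"

text \<open>Small steps on a stack of commands. An impossible action loops, so a computation that halts has
  performed none.\<close>

fun stp :: "com list \<times> tape \<times> nat list \<Rightarrow> com list \<times> tape \<times> nat list" where
  "stp ([], s, out) = ([], s, out)"
| "stp (Nop # k, s, out) = (k, s, out)"
| "stp (Do a # k, s, out) = (case act_step a s of None \<Rightarrow> (Do a # k, s, out)
     | Some (out', s') \<Rightarrow> (k, s', out @ out'))"
| "stp (Seq c d # k, s, out) = (c # d # k, s, out)"
| "stp (Cond b c d # k, s, out) = ((if test b s then c else d) # k, s, out)"
| "stp (Loop b c # k, s, out) = (if test b s then c # Loop b c # k else k, s, out)"

section \<open>Halting computations and the number of configurations\<close>

lemma ex_stp: "ex c s out s' \<Longrightarrow> \<exists>n. \<forall>k o1. (stp ^^ n) (c # k, s, o1) = (k, s', o1 @ out)"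
proof (induction rule: ex.induct)
  case (ex_Nop s)
  show ?case by (rule exI[of _ 1]) simp
next
  case (ex_Do a s out s')
  then show ?case by (intro exI[of _ 1]) simp
next
  case (ex_Seq c s o1 s' d o2 s'')
  then obtain m n where "\<forall>k r. (stp ^^ m) (c # k, s, r) = (k, s', r @ o1)"
    "\<forall>k r. (stp ^^ n) (d # k, s', r) = (k, s'', r @ o2)" by blast
  then show ?case
    by (intro exI[of _ "n + m + 1"]) (simp add: funpow_add del: funpow.simps(2) add: funpow_Suc_right)
next
  case (ex_CondT b s c out s' d)
  then obtain m where "\<forall>k r. (stp ^^ m) (c # k, s, r) = (k, s', r @ out)" by blast
  then show ?case using ex_CondT(1)
    by (intro exI[of _ "Suc m"]) (simp del: funpow.simps(2) add: funpow_Suc_right)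
next
  case (ex_CondF b s d out s' c)
  then obtain m where "\<forall>k r. (stp ^^ m) (d # k, s, r) = (k, s', r @ out)" by blast
  then show ?case using ex_CondF(1)
    by (intro exI[of _ "Suc m"]) (simp del: funpow.simps(2) add: funpow_Suc_right)
next
  case (ex_LoopF b s c)
  then show ?case by (intro exI[of _ 1]) simp
next
  case (ex_LoopT b s c o1 s' o2 s'')
  then obtain m n where "\<forall>k r. (stp ^^ m) (c # k, s, r) = (k, s', r @ o1)"
    "\<forall>k r. (stp ^^ n) (Loop b c # k, s', r) = (k, s'', r @ o2)" by blast
  then show ?case using ex_LoopT(1)
    by (intro exI[of _ "n + m + 1"]) (simp add: funpow_add del: funpow.simps(2) add: funpow_Suc_right)
qed

text \<open>The stacks that can occur while \<open>c\<close> runs on top of \<open>k\<close>. They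
  are finitely many because a loop body returns to the loop itself, and so they can serve as control
  states.\<close>

fun conts :: "com \<Rightarrow> com list \<Rightarrow> com list set" where
  "conts Nop k = {Nop # k}"
| "conts (Do a) k = {Do a # k}"
| "conts (Seq c d) k = insert (Seq c d # k) (conts c (d # k) \<union> conts d k)"
| "conts (Cond b c d) k = insert (Cond b c d # k) (conts c k \<union> conts d k)"
| "conts (Loop b c) k = insert (Loop b c # k) (conts c (Loop b c # k))"

lemma finite_conts: "finite (conts c k)"
  by (induction c arbitrary: k) auto

lemma conts_start: "c # k \<in> conts c k"
  by (cases c) auto

fun succs :: "com list \<Rightarrow> com list set" where
  "succs [] = {[]}"
| "succs (Nop # k) = {k}"
| "succs (Do a # k) = {k, Do a # k}"
| "succs (Seq c d # k) = {c # d # k}"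
| "succs (Cond b c d # k) = {c # k, d # k}"
| "succs (Loop b c # k) = {c # Loop b c # k, k}"

lemma succs_conts: "l \<in> conts c k \<Longrightarrow> succs l \<subseteq> insert k (conts c k)"
proof (induction c arbitrary: k)
  case (Seq c d)
  then show ?case using conts_start by fastforce
next
  case (Cond b c d)
  then show ?case using conts_start by fastforce
next
  case (Loop b c)
  then show ?case using conts_start by fastforce
qed auto

lemma stp_succs: "fst (stp c) \<in> succs (fst c)"
  by (cases c rule: stp.cases) (auto split: option.splits)

lemma stp_halted: "fst c = [] \<Longrightarrow> stp c = c"
  by (cases c) simp

lemma stp_halted_iter: "fst c = [] \<Longrightarrow> (stp ^^ n) c = c"
  by (induction n) (auto simp: stp_halted)

text \<open>The output is dropped: it never influences the computation, and with it no configuration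
  count would be finite.\<close>

definition core :: "com list \<times> tape \<times> nat list \<Rightarrow> com list \<times> tape" where
  "core c = (fst c, fst (snd c))"

lemma core_stp: "core c = core c' \<Longrightarrow> core (stp c) = core (stp c')"
  unfolding core_def
  by (cases c rule: stp.cases; cases c' rule: stp.cases) (auto split: option.splits)

lemma core_iter: "core c = core c' \<Longrightarrow> core ((stp ^^ n) c) = core ((stp ^^ n) c')"
  by (induction n) (auto intro: core_stp)

definition tape_ok :: "nat list \<Rightarrow> tape \<Rightarrow> bool" where
  "tape_ok w s = (case s of (u, v, p) \<Rightarrow> rev u @ v = w \<and> (p = None \<or> p \<in> Some ` {..length w}))"

lemma act_ok: "act_step a s = Some (out, s') \<Longrightarrow> tape_ok w s \<Longrightarrow> tape_ok w s'"
  by (cases s; cases a) (auto simp: tape_ok_def split: list.splits if_splits)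

lemma stp_ok: "tape_ok w (fst (snd c)) \<Longrightarrow> tape_ok w (fst (snd (stp c)))"
  by (cases c rule: stp.cases) (auto split: option.splits intro: act_ok)

text \<open>For a fixed word, the head position and the pebble, possibly absent, determine the
  zipper.\<close>

lemma card_tapes:
  "finite {s. tape_ok w s}" "card {s. tape_ok w s} \<le> (length w + 1) * (length w + 2)"
proof -
  let ?F = "\<lambda>(h, p). (rev (take h w), drop h w, p)"
  let ?D = "{..length w} \<times> insert None (Some ` {..length w})"
  have sub: "{s. tape_ok w s} \<subseteq> ?F ` ?D"
  proof
    fix s assume s: "s \<in> {s. tape_ok w s}"
    obtain u v p where "s = (u, v, p)" by (cases s)
    with s show "s \<in> ?F ` ?D"
      by (intro image_eqI[of _ _ "(length u, p)"]) (auto simp: tape_ok_def)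
  qed
  have fin: "finite ?D" by simp
  then show "finite {s. tape_ok w s}" using sub finite_subset by blast
  have "card {s. tape_ok w s} \<le> card (?F ` ?D)" by (rule card_mono[OF _ sub]) (use fin in blast)
  also have "\<dots> \<le> card ?D" by (rule card_image_le[OF fin])
  also have "\<dots> = (length w + 1) * (length w + 2)"
    by (simp add: card_cartesian_product card_insert_if card_image)
  finally show "card {s. tape_ok w s} \<le> (length w + 1) * (length w + 2)" .
qed

definition nconts :: "com \<Rightarrow> nat" where
  "nconts c = card (insert [] (conts c []))"

text \<open>A halting computation never repeats a configuration, which bounds its length by the number
  of configurations; no cost analysis of individual programs is needed.\<close>

lemma ex_bounded:
  assumes ex: "ex c ([], w, None) out s'"
  shows "\<exists>N \<le> nconts c * ((length w + 1) * (length w + 2)).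
    (stp ^^ N) ([c], ([], w, None), []) = ([], s', out) \<and>
    (\<forall>i<N. core ((stp ^^ i) ([c], ([], w, None), [])) \<noteq> core ((stp ^^ Suc i) ([c], ([], w, None), [])))
    \<and> (\<forall>i. fst ((stp ^^ i) ([c], ([], w, None), [])) \<in> insert [] (conts c [])
         \<and> tape_ok w (fst (snd ((stp ^^ i) ([c], ([], w, None), [])))))"
proof -
  define c0 where "c0 = ([c], ([] :: nat list, w, None :: nat option), [] :: nat list)"
  obtain n where n: "(stp ^^ n) c0 = ([], s', out)"
    using ex_stp[OF ex] unfolding c0_def by (metis append_Nil)
  define N where "N = (LEAST n. fst ((stp ^^ n) c0) = [])"
  have N: "fst ((stp ^^ N) c0) = []" unfolding N_def by (rule LeastI[of _ n]) (simp add: n)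
  have Nn: "N \<le> n" unfolding N_def by (rule Least_le) (simp add: n)
  have fin: "(stp ^^ N) c0 = ([], s', out)"
    using stp_halted_iter[OF N, of "n - N"] n Nn by (metis comp_apply funpow_add le_add_diff_inverse2)
  \<comment> \<open>After a repetition the remaining steps could start at the earlier occurrence and
    would halt before \<open>N\<close>.\<close>
  have diff: "core ((stp ^^ i) c0) \<noteq> core ((stp ^^ j) c0)" if "i < j" "j \<le> N" for i j
  proof
    assume "core ((stp ^^ i) c0) = core ((stp ^^ j) c0)"
    then have "core ((stp ^^ (N - j)) ((stp ^^ i) c0)) = core ((stp ^^ (N - j)) ((stp ^^ j) c0))"
      by (rule core_iter)
    then have "core ((stp ^^ (N - j + i)) c0) = core ((stp ^^ N) c0)"
      using that by (metis comp_apply funpow_add le_add_diff_inverse2)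
    then have "fst ((stp ^^ (N - j + i)) c0) = []" using N by (simp add: core_def)
    moreover have "N - j + i < N" using that by simp
    ultimately show False unfolding N_def using not_less_Least by blast
  qed
  have inv: "fst ((stp ^^ i) c0) \<in> insert [] (conts c []) \<and> tape_ok w (fst (snd ((stp ^^ i) c0)))" for i
  proof (induction i)
    case 0
    then show ?case by (simp add: c0_def conts_start tape_ok_def)
  next
    case (Suc i)
    have "fst (stp ((stp ^^ i) c0)) \<in> succs (fst ((stp ^^ i) c0))" by (rule stp_succs)
    then have "fst (stp ((stp ^^ i) c0)) \<in> insert [] (conts c [])"
      using Suc succs_conts[of _ c "[]"] by (cases "fst ((stp ^^ i) c0) = []") auto
    then show ?case using Suc stp_ok by simp
  qed
  let ?D = "insert [] (conts c []) \<times> {s. tape_ok w s}"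
  have "inj_on (\<lambda>i. core ((stp ^^ i) c0)) {..N}"
    by (rule linorder_inj_onI) (use diff in auto)
  then have "card {..N} = card ((\<lambda>i. core ((stp ^^ i) c0)) ` {..N})" by (simp add: card_image)
  also have "\<dots> \<le> card ?D"
    by (rule card_mono) (use inv in \<open>auto simp: finite_conts card_tapes core_def\<close>)
  also have "\<dots> \<le> nconts c * ((length w + 1) * (length w + 2))"
    unfolding card_cartesian_product nconts_def by (rule mult_le_mono2[OF card_tapes(2)])
  finally have "N \<le> nconts c * ((length w + 1) * (length w + 2))" by simp
  \<comment> \<open>In particular no step is stuck on an impossible action; the simulation by a
    Turing machine relies on this.\<close>
  moreover have "\<forall>i<N. core ((stp ^^ i) c0) \<noteq> core ((stp ^^ Suc i) c0)"
    using diff[OF lessI] by (metis Suc_leI)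
  ultimately show ?thesis using fin inv unfolding c0_def[symmetric] by blast
qed

section \<open>Turing machines for the structured language\<close>

text \<open>A tape cell holds an input symbol, an output symbol, and marks for the head position
  (while output is written), the pebble, and the left end. A cell with only an input
  symbol is that symbol.\<close>

definition cell :: "nat \<Rightarrow> nat \<Rightarrow> bool \<Rightarrow> bool \<Rightarrow> bool \<Rightarrow> nat" where
  "cell i r H P L = i + 27 * (r + 27 * (of_bool H + 2 * (of_bool P + 2 * of_bool L)))"

definition c_in :: "nat \<Rightarrow> nat" where "c_in a = a mod 27"
definition c_out :: "nat \<Rightarrow> nat" where "c_out a = a div 27 mod 27"
definition c_H :: "nat \<Rightarrow> bool" where "c_H a = odd (a div 27 div 27)"
definition c_P :: "nat \<Rightarrow> bool" where "c_P a = odd (a div 27 div 27 div 2)"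
definition c_L :: "nat \<Rightarrow> bool" where "c_L a = odd (a div 27 div 27 div 2 div 2)"

lemma cell_simps [simp]:
  assumes "i < 27" "r < 27"
  shows "c_in (cell i r H P L) = i" "c_out (cell i r H P L) = r" "c_H (cell i r H P L) = H"
    "c_P (cell i r H P L) = P" "c_L (cell i r H P L) = L"
proof -
  have dv: "(a + 27 * x) div 27 = x" "(a + 27 * x) mod 27 = a" if "a < 27" for a x :: nat
    using that by simp_all
  have bt: "(of_bool B + 2 * x) div 2 = x" "odd (of_bool B + 2 * x) = B" for B and x :: nat
    by (cases B; simp)+
  have L: "odd (of_bool L :: nat) = L" by simp
  show "c_in (cell i r H P L) = i" "c_out (cell i r H P L) = r" "c_H (cell i r H P L) = H"
    "c_P (cell i r H P L) = P" "c_L (cell i r H P L) = L"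
    unfolding c_in_def c_out_def c_H_def c_P_def c_L_def cell_def
    by (simp_all only: dv[OF assms(1)] dv[OF assms(2)] bt L)
qed

text \<open>5832 = 27 * 27 * 8, for two symbols and three marks.\<close>

lemma cell_less: "i < 27 \<Longrightarrow> r < 27 \<Longrightarrow> cell i r H P L < 5832"
  unfolding cell_def by (cases H; cases P; cases L; simp)

lemma c_less [simp]: "c_in a < 27" "c_out a < 27"
  by (simp_all add: c_in_def c_out_def)

text \<open>Output is appended on a track of its own. The head position is marked,
  \<open>OutL\<close> walks to the left end, \<open>OutW\<close> to the first free output cell,
  \<open>OutB\<close> back to the left end and \<open>OutR\<close> to the mark. Finally
  \<open>FinL\<close> and \<open>FinW\<close> replace the cells by their output symbols.\<close>

datatype ctl =
    Ini
  | Run "com list"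
  | OutL nat "com list" | OutW nat "com list" | OutB "com list" | OutR "com list"
  | FinL | FinW | Hlt

fun delta :: "com \<Rightarrow> ctl \<Rightarrow> nat \<Rightarrow> ctl \<times> nat \<times> move" where
  "delta c Ini a = (Run [c], cell (c_in a) (c_out a) (c_H a) (c_P a) True, Stay)"
| "delta c (Run []) a = (FinL, a, Stay)"
| "delta c (Run (Nop # k)) a = (Run k, a, Stay)"
| "delta c (Run (Seq d e # k)) a = (Run (d # e # k), a, Stay)"
| "delta c (Run (Cond b d e # k)) a
     = (Run ((if b (c_in a) (c_P a) (c_L a) then d else e) # k), a, Stay)"
| "delta c (Run (Loop b d # k)) a
     = (Run (if b (c_in a) (c_P a) (c_L a) then d # Loop b d # k else k), a, Stay)"
| "delta c (Run (Do MvR # k)) a = (Run k, a, GoR)"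
| "delta c (Run (Do MvL # k)) a = (Run k, a, GoL)"
| "delta c (Run (Do SetP # k)) a = (Run k, cell (c_in a) (c_out a) (c_H a) True (c_L a), Stay)"
| "delta c (Run (Do ClrP # k)) a = (Run k, cell (c_in a) (c_out a) (c_H a) False (c_L a), Stay)"
| "delta c (Run (Do (Out f) # k)) a
     = (OutL f k, cell (c_in a) (c_out a) True (c_P a) (c_L a), Stay)"
| "delta c (OutL f k) a = (if c_L a then (OutW f k, a, Stay) else (OutL f k, a, GoL))"
| "delta c (OutW f k) a = (if c_out a = 0
     then (OutB k, cell (c_in a) (f mod 27) (c_H a) (c_P a) (c_L a), Stay)
     else (OutW f k, a, GoR))"
| "delta c (OutB k) a = (if c_L a then (OutR k, a, Stay) else (OutB k, a, GoL))"
| "delta c (OutR k) a = (if c_H a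
     then (Run k, cell (c_in a) (c_out a) False (c_P a) (c_L a), Stay)
     else (OutR k, a, GoR))"
| "delta c FinL a = (if c_L a then (FinW, a, Stay) else (FinL, a, GoL))"
| "delta c FinW a = (if c_out a = 0 then (Hlt, 0, Stay) else (FinW, c_out a, GoR))"
| "delta c Hlt a = (Hlt, a, Stay)"

section \<open>Cost of the simulation\<close>

definition cstep :: "com \<Rightarrow> ctl \<times> (nat \<Rightarrow> nat) \<times> nat \<Rightarrow> ctl \<times> (nat \<Rightarrow> nat) \<times> nat" where
  "cstep c s = (case s of (q, t, h) \<Rightarrow> if q = Hlt then s else
     (case delta c q (t h) of (q', b, m) \<Rightarrow>
        (q', t(h := b), case m of GoL \<Rightarrow> h - 1 | GoR \<Rightarrow> Suc h | Stay \<Rightarrow> h)))"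

inductive reach :: "com \<Rightarrow> nat \<Rightarrow> ctl \<times> (nat \<Rightarrow> nat) \<times> nat \<Rightarrow> ctl \<times> (nat \<Rightarrow> nat) \<times> nat \<Rightarrow> bool"
  for c where
  "reach c n s s"
| "reach c n (cstep c s) s' \<Longrightarrow> reach c (Suc n) s s'"

lemma reach_iff: "reach c n s s' \<longleftrightarrow> (\<exists>m\<le>n. (cstep c ^^ m) s = s')"
proof
  show "reach c n s s' \<Longrightarrow> \<exists>m\<le>n. (cstep c ^^ m) s = s'"
  proof (induction rule: reach.induct)
    case (1 n s)
    show ?case by (rule exI[of _ 0]) simp
  next
    case (2 n s s')
    then obtain m where "m \<le> n" "(cstep c ^^ m) (cstep c s) = s'" by blast
    then show ?case
      by (intro exI[of _ "Suc m"]) (simp del: funpow.simps(2) add: funpow_Suc_right)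
  qed
next
  have "(cstep c ^^ m) s = s' \<Longrightarrow> m \<le> n \<Longrightarrow> reach c n s s'" for m
  proof (induction m arbitrary: s n)
    case 0
    then show ?case by (auto intro: reach.intros)
  next
    case (Suc m)
    then obtain n' where n: "n = Suc n'" "m \<le> n'" by (cases n) auto
    have "(cstep c ^^ m) (cstep c s) = s'" using Suc.prems(1)
      by (simp del: funpow.simps(2) add: funpow_Suc_right)
    from Suc.IH[OF this n(2)] show ?case unfolding n(1) by (rule reach.intros)
  qed
  then show "\<exists>m\<le>n. (cstep c ^^ m) s = s' \<Longrightarrow> reach c n s s'" by blast
qed

lemma reach_trans: "reach c n s s' \<Longrightarrow> reach c m s' s'' \<Longrightarrow> reach c (n + m) s s''"
proof (induction rule: reach.induct)
  case (1 n s)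
  then show ?case by (metis reach_iff le_add2 order_trans)
qed (auto intro: reach.intros)

lemma reach_1: "cstep c s = s' \<Longrightarrow> 0 < n \<Longrightarrow> reach c n s s'"
  by (cases n) (auto intro: reach.intros)

lemma reach_Suc: "cstep c s = s' \<Longrightarrow> reach c n s' s'' \<Longrightarrow> reach c (Suc n) s s''"
  by (auto intro: reach.intros)

lemma reach_mono: "reach c n s s' \<Longrightarrow> n \<le> m \<Longrightarrow> reach c m s s'"
  by (metis reach_iff order_trans)

definition tp :: "nat list \<Rightarrow> nat option \<Rightarrow> nat list \<Rightarrow> nat option \<Rightarrow> nat \<Rightarrow> nat" where
  "tp w p r H x = cell (rd w x) (rd r x) (H = Some x) (p = Some x) (x = 0)"

abbreviation sy :: "nat list \<Rightarrow> bool" where "sy w \<equiv> set w \<subseteq> {0<..<27}"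

lemma rd_less [simp]: "sy w \<Longrightarrow> rd w x < 27"
  unfolding rd_def by (auto dest!: nth_mem)

lemma rd_0: "sy w \<Longrightarrow> rd w x = 0 \<longleftrightarrow> length w \<le> x"
  unfolding rd_def by (auto simp: not_less dest!: nth_mem)

lemma tp_simps [simp]:
  assumes "sy w" "sy r"
  shows "c_in (tp w p r H x) = rd w x" "c_out (tp w p r H x) = rd r x"
    "c_H (tp w p r H x) \<longleftrightarrow> H = Some x" "c_P (tp w p r H x) \<longleftrightarrow> p = Some x"
    "c_L (tp w p r H x) \<longleftrightarrow> x = 0"
  using assms by (simp_all add: tp_def)

lemma reach_OutL:
  assumes "sy w" "sy r"
  shows "reach c (h + 1) (OutL f k, tp w p r H, h) (OutW f k, tp w p r H, 0)"
proof (induction h)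
  case 0
  show ?case by (rule reach_1) (use assms in \<open>simp_all add: cstep_def\<close>)
next
  case (Suc h)
  have "cstep c (OutL f k, tp w p r H, Suc h) = (OutL f k, tp w p r H, h)"
    using assms by (simp add: cstep_def)
  from reach_Suc[OF this Suc] show ?case by simp
qed

lemma reach_OutB:
  assumes "sy w" "sy r"
  shows "reach c (h + 1) (OutB k, tp w p r H, h) (OutR k, tp w p r H, 0)"
proof (induction h)
  case 0
  show ?case by (rule reach_1) (use assms in \<open>simp_all add: cstep_def\<close>)
next
  case (Suc h)
  have "cstep c (OutB k, tp w p r H, Suc h) = (OutB k, tp w p r H, h)"
    using assms by (simp add: cstep_def)
  from reach_Suc[OF this Suc] show ?case by simp
qed

lemma reach_FinL:
  assumes "sy w" "sy r"
  shows "reach c (h + 1) (FinL, tp w p r H, h) (FinW, tp w p r H, 0)"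
proof (induction h)
  case 0
  show ?case by (rule reach_1) (use assms in \<open>simp_all add: cstep_def\<close>)
next
  case (Suc h)
  have "cstep c (FinL, tp w p r H, Suc h) = (FinL, tp w p r H, h)"
    using assms by (simp add: cstep_def)
  from reach_Suc[OF this Suc] show ?case by simp
qed

lemma reach_OutW:
  assumes "sy w" "sy r" "0 < f" "f < 27"
  shows "d \<le> length r \<Longrightarrow> reach c (d + 1) (OutW f k, tp w p r H, length r - d)
    (OutB k, tp w p (r @ [f]) H, length r)"
proof (induction d)
  case 0
  have "(tp w p r H)(length r := cell (rd w (length r)) f (H = Some (length r))
      (p = Some (length r)) (length r = 0)) = tp w p (r @ [f]) H"
    by (rule ext) (auto simp: tp_def rd_def nth_append)
  then have "cstep c (OutW f k, tp w p r H, length r) = (OutB k, tp w p (r @ [f]) H, length r)"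
    using assms by (simp add: cstep_def rd_0)
  then show ?case by (intro reach_1) simp_all
next
  case (Suc d)
  then have "Suc (length r - Suc d) = length r - d" by simp
  then have "cstep c (OutW f k, tp w p r H, length r - Suc d) = (OutW f k, tp w p r H, length r - d)"
    using assms Suc.prems by (simp add: cstep_def rd_0)
  from reach_Suc[OF this] show ?case using Suc by simp
qed

lemma reach_OutR:
  assumes "sy w" "sy r"
  shows "d \<le> h \<Longrightarrow> reach c (d + 1) (OutR k, tp w p r (Some h), h - d) (Run k, tp w p r None, h)"
proof (induction d)
  case 0
  have "(tp w p r (Some h))(h := cell (rd w h) (rd r h) False (p = Some h) (h = 0)) = tp w p r None"
    by (rule ext) (auto simp: tp_def)
  then have "cstep c (OutR k, tp w p r (Some h), h) = (Run k, tp w p r None, h)"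
    using assms by (simp add: cstep_def)
  then show ?case by (intro reach_1) simp_all
next
  case (Suc d)
  then have h: "Suc (h - Suc d) = h - d" by simp
  have "cstep c (OutR k, tp w p r (Some h), h - Suc d) = (OutR k, tp w p r (Some h), h - d)"
    using assms Suc.prems h by (simp add: cstep_def)
  from reach_Suc[OF this] show ?case using Suc by simp
qed

lemma reach_Out:
  assumes "sy w" "sy r" "0 < f" "f < 27"
  shows "reach c (2 * h + 2 * length r + 6) (Run (Do (Out f) # k), tp w p r None, h)
    (Run k, tp w p (r @ [f]) None, h)"
proof -
  have "(tp w p r None)(h := cell (rd w h) (rd r h) True (p = Some h) (h = 0)) = tp w p r (Some h)"
    by (rule ext) (auto simp: tp_def)
  then have 1: "reach c 1 (Run (Do (Out f) # k), tp w p r None, h) (OutL f k, tp w p r (Some h), h)"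
    by (intro reach_1) (use assms(1,2) in \<open>simp_all add: cstep_def\<close>)
  have r: "sy (r @ [f])" using assms by auto
  have 2: "reach c (h + 1) (OutL f k, tp w p r (Some h), h) (OutW f k, tp w p r (Some h), 0)"
    by (rule reach_OutL[OF assms(1,2)])
  have 3: "reach c (length r + 1) (OutW f k, tp w p r (Some h), 0)
      (OutB k, tp w p (r @ [f]) (Some h), length r)"
    using reach_OutW[OF assms, of "length r"] by simp
  have 4: "reach c (length r + 1) (OutB k, tp w p (r @ [f]) (Some h), length r)
      (OutR k, tp w p (r @ [f]) (Some h), 0)"
    by (rule reach_OutB[OF assms(1) r])
  have 5: "reach c (h + 1) (OutR k, tp w p (r @ [f]) (Some h), 0) (Run k, tp w p (r @ [f]) None, h)"
    using reach_OutR[OF assms(1) r, of h h] by simp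
  show ?thesis
    by (rule reach_mono[OF reach_trans[OF 1 reach_trans[OF 2 reach_trans[OF 3 reach_trans[OF 4 5]]]]])
      simp
qed

text \<open>Assumption \<open>ch\<close> excludes impossible actions, on which the machine would not
  stall. The cost is that of appending a symbol: twice to the left end and back.\<close>

lemma reach_stp:
  assumes w: "sy w" and r: "sy r" and ok: "tape_ok w (u, v, p)" and k: "k \<noteq> []"
    and step: "stp (k, (u, v, p), r) = (k', (u', v', p'), r')"
    and ch: "core (k, (u, v, p), r) \<noteq> core (k', (u', v', p'), r')"
  shows "reach c (2 * length w + 2 * length r + 6) (Run k, tp w p r None, length u)
      (Run k', tp w p' r' None, length u')
    \<and> sy r' \<and> length r' \<le> length r + 1"
proof -
  have v: "rd v 0 = rd w (length u)"
    using ok by (auto simp: tape_ok_def rd_def nth_append)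
  have lu: "length u \<le> length w" using ok by (auto simp: tape_ok_def)
  have t: "test b (u, v, p) = b (rd w (length u)) (p = Some (length u)) (length u = 0)" for b
    by (simp add: test_def v)
  obtain d l where kd: "k = d # l" using k by (cases k) auto
  have self: "(tp w p r None)(h := tp w p r None h) = tp w p r None" for h by simp
  show ?thesis
  proof (cases d)
    case (Do a)
    show ?thesis
    proof (cases a)
      case (Out f)
      then have "0 < f" "f < 27" "(k', (u', v', p'), r') = (l, (u, v, p), r @ [f])"
        using step ch Do kd by (auto simp: core_def split: if_splits)
      then show ?thesis using reach_mono[OF reach_Out[OF w r, of f c "length u" l p]] lu r Do Out kd
        by auto
    next
      case MvR
      then show ?thesis using step ch Do kd w r
        by (auto simp: core_def cstep_def split: list.splits intro!: reach_1)
    next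
      case MvL
      then show ?thesis using step ch Do kd w r
        by (auto simp: core_def cstep_def split: list.splits intro!: reach_1)
    next
      case SetP
      have "(tp w None r None)(h := cell (rd w h) (rd r h) False True (u = [])) = tp w (Some h) r None"
        if "h = length u" for h by (rule ext) (auto simp: tp_def that)
      then show ?thesis using step ch Do kd w r SetP
        by (auto simp: core_def cstep_def split: if_splits intro!: reach_1)
    next
      case ClrP
      have "(tp w (Some h) r None)(h := cell (rd w h) (rd r h) False False (u = [])) = tp w None r None"
        if "h = length u" for h by (rule ext) (auto simp: tp_def that)
      then show ?thesis using step ch Do kd w r ClrP
        by (auto simp: core_def cstep_def split: if_splits intro!: reach_1)
    qed
  qed (use step kd w r t in \<open>auto simp: cstep_def intro!: reach_1\<close>)
qed

text \<open>A step outputs at most one symbol, so the output is never longer than \<open>N\<close>;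
  this bounds the cost of all appends uniformly.\<close>

lemma reach_run:
  assumes w: "sy w" and ex: "ex c ([], w, None) r s"
  shows "\<exists>N p. N \<le> nconts c * ((length w + 1) * (length w + 2)) \<and>
    reach c (N * (2 * length w + 2 * N + 6)) (Run [c], tp w None [] None, 0)
      (Run [], tp w p r None, length (fst s)) \<and> sy r \<and> length r \<le> N \<and> length (fst s) \<le> length w"
proof -
  define X where "X i = (stp ^^ i) ([c], ([] :: nat list, w, None :: nat option), [] :: nat list)" for i
  obtain N where N: "N \<le> nconts c * ((length w + 1) * (length w + 2))" "X N = ([], s, r)"
    and ch: "\<And>i. i < N \<Longrightarrow> core (X i) \<noteq> core (X (Suc i))"
    and ok: "\<And>i. tape_ok w (fst (snd (X i)))"
    using ex_bounded[OF ex] unfolding X_def by metis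
  have "i \<le> N \<Longrightarrow> X i = (k, (u, v, p), r') \<Longrightarrow>
    reach c (i * (2 * length w + 2 * N + 6)) (Run [c], tp w None [] None, 0)
      (Run k, tp w p r' None, length u) \<and> sy r' \<and> length r' \<le> i" for i k u v p r'
  proof (induction i arbitrary: k u v p r')
    case 0
    then show ?case by (auto simp: X_def intro: reach.intros)
  next
    case (Suc i)
    obtain k1 u1 v1 p1 r1 where x: "X i = (k1, (u1, v1, p1), r1)" by (cases "X i") auto
    have st: "stp (X i) = X (Suc i)" by (simp add: X_def)
    have IH: "reach c (i * (2 * length w + 2 * N + 6)) (Run [c], tp w None [] None, 0)
      (Run k1, tp w p1 r1 None, length u1)" "sy r1" "length r1 \<le> i"
      using Suc.IH[OF _ x] Suc.prems by auto
    have "k1 \<noteq> []" using ch[of i] st x Suc.prems by auto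
    then have S: "reach c (2 * length w + 2 * length r1 + 6) (Run k1, tp w p1 r1 None, length u1)
      (Run k, tp w p r' None, length u)" "sy r'" "length r' \<le> length r1 + 1"
      using reach_stp[OF w IH(2), of u1 v1 p1 k1 k u v p r' c] ok[of i] st x Suc.prems ch[of i]
      by auto
    have "reach c (2 * length w + 2 * N + 6) (Run k1, tp w p1 r1 None, length u1)
      (Run k, tp w p r' None, length u)"
      by (rule reach_mono[OF S(1)]) (use IH(3) Suc.prems in simp)
    from reach_trans[OF IH(1) this] show ?case using S(2,3) IH(3) by (simp add: add.commute)
  qed
  note main = this
  obtain u v p where s: "s = (u, v, p)" by (cases s)
  have "length u \<le> length w" using ok[of N] N(2) s by (auto simp: tape_ok_def)
  then show ?thesis using main[of N "[]" u v p r] N s by auto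
qed

text \<open>Remains of the input beyond the output do no harm: output symbols are nonzero and a 0 is
  written after the last one, where \<open>tape_out\<close> stops.\<close>

lemma reach_FinW:
  assumes "sy w" "sy r"
  shows "d \<le> length r \<Longrightarrow> (\<And>x. x < length r - d \<Longrightarrow> t x = r ! x) \<Longrightarrow>
      (\<And>x. length r - d \<le> x \<Longrightarrow> t x = tp w p r None x) \<Longrightarrow>
    \<exists>t' h'. reach c (d + 1) (FinW, t, length r - d) (Hlt, t', h') \<and> tape_out t' = r"
proof (induction d arbitrary: t)
  case 0
  have n0: "r ! x \<noteq> 0" if "x < length r" for x
    using nth_mem[OF that] assms(2) by auto
  let ?t = "t(length r := 0)"
  have "cstep c (FinW, t, length r) = (Hlt, ?t, length r)"
    using 0 assms by (simp add: cstep_def rd_0)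
  moreover have "(LEAST k. ?t k = 0) = length r"
  proof (rule Least_equality)
    fix y assume y: "?t y = 0"
    show "length r \<le> y"
    proof (rule ccontr)
      assume "\<not> length r \<le> y"
      then show False using y 0(2)[of y] n0[of y] by simp
    qed
  qed simp
  then have "tape_out ?t = r"
    unfolding tape_out_def using 0 by (auto intro!: nth_equalityI)
  ultimately show ?case by (auto intro!: reach_1)
next
  case (Suc d)
  let ?x = "length r - Suc d"
  have x: "?x < length r" "Suc ?x = length r - d" using Suc.prems(1) by auto
  have tx: "t ?x = tp w p r None ?x" using Suc.prems(3) by simp
  have rx: "rd r ?x = r ! ?x" "rd r ?x \<noteq> 0"
    using x(1) rd_0[OF assms(2), of ?x] by (simp_all add: rd_def)
  have st: "cstep c (FinW, t, ?x) = (FinW, t(?x := r ! ?x), length r - d)"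
    using tx rx assms x by (simp add: cstep_def)
  have "\<exists>t' h'. reach c (d + 1) (FinW, t(?x := r ! ?x), length r - d) (Hlt, t', h') \<and> tape_out t' = r"
    by (rule Suc.IH) (use Suc.prems x in \<open>auto simp: less_Suc_eq\<close>)
  with reach_Suc[OF st] show ?case by fastforce
qed

lemma reach_total:
  assumes w: "sy w" and ex: "ex c ([], w, None) r s"
  shows "\<exists>N t h. N \<le> nconts c * ((length w + 1) * (length w + 2)) \<and> tape_out t = r \<and>
    reach c (N * (2 * length w + 2 * N + 6) + length w + N + 5)
      (Ini, rd w, 0) (Hlt, t, h)"
proof -
  obtain N p where N: "N \<le> nconts c * ((length w + 1) * (length w + 2))"
    and r: "reach c (N * (2 * length w + 2 * N + 6)) (Run [c], tp w None [] None, 0)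
      (Run [], tp w p r None, length (fst s))" "sy r" "length r \<le> N" "length (fst s) \<le> length w"
    using reach_run[OF assms] by metis
  \<comment> \<open>A bare input symbol is a cell with empty output and no marks, so
    \<open>Ini\<close> only has to mark the left end.\<close>
  have c0: "rd w x = cell (rd w x) 0 False False False" for x by (simp add: cell_def)
  have "(rd w)(0 := cell (rd w 0) 0 False False True) = tp w None [] None"
    by (rule ext) (auto simp: tp_def rd_def[of "[]"] c0[symmetric])
  moreover have "c_in (rd w x) = rd w x" "c_out (rd w x) = 0" "\<not> c_H (rd w x)" "\<not> c_P (rd w x)" for x
    using cell_simps[of "rd w x" 0 False False False] w unfolding c0[symmetric] by auto
  ultimately have 1: "reach c 1 (Ini, rd w, 0) (Run [c], tp w None [] None, 0)"
    by (intro reach_1) (simp_all add: cstep_def)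
  have 2: "reach c 1 (Run [], tp w p r None, length (fst s)) (FinL, tp w p r None, length (fst s))"
    by (intro reach_1) (simp_all add: cstep_def)
  have 3: "reach c (length (fst s) + 1) (FinL, tp w p r None, length (fst s)) (FinW, tp w p r None, 0)"
    by (rule reach_FinL[OF w r(2)])
  obtain t h where t: "reach c (length r + 1) (FinW, tp w p r None, 0) (Hlt, t, h)" "tape_out t = r"
    using reach_FinW[OF w r(2), of "length r" "tp w p r None" p c] by auto
  have "reach c (N * (2 * length w + 2 * N + 6) + length w + N + 5) (Ini, rd w, 0) (Hlt, t, h)"
    by (rule reach_mono[OF reach_trans[OF 1 reach_trans[OF r(1) reach_trans[OF 2 reach_trans[OF 3 t(1)]]]]])
      (use r(3,4) in simp)
  then show ?thesis using N t(2) by blast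
qed

section \<open>Numbering the control states\<close>

definition ctls :: "com \<Rightarrow> ctl set" where
  "ctls c = (let S = insert [] (conts c []) in {q. case q of
     Run k \<Rightarrow> k \<in> S | OutB k \<Rightarrow> k \<in> S | OutR k \<Rightarrow> k \<in> S
   | OutL f k \<Rightarrow> k \<in> S \<and> Do (Out f) # k \<in> S | OutW f k \<Rightarrow> k \<in> S \<and> Do (Out f) # k \<in> S
   | _ \<Rightarrow> True})"

text \<open>The symbol carried by \<open>OutL\<close> and \<open>OutW\<close> is tied to an
  occurrence of \<open>Out\<close> in the program; otherwise it would range over all
  numbers.\<close>

lemma finite_ctls: "finite (ctls c)"
proof -
  let ?S = "insert [] (conts c [])"
  have S: "finite ?S" by (simp add: finite_conts)
  let ?h = "\<lambda>l. case l of Do (Out f) # k \<Rightarrow> {OutL f k, OutW f k} | _ \<Rightarrow> {}"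
  let ?B = "{Ini, FinL, FinW, Hlt} \<union> Run ` ?S \<union> OutB ` ?S \<union> OutR ` ?S \<union> (\<Union>l\<in>?S. ?h l)"
  have "ctls c \<subseteq> ?B"
  proof
    fix q assume q: "q \<in> ctls c"
    show "q \<in> ?B"
    proof (cases q)
      case (OutL f k)
      then have "Do (Out f) # k \<in> ?S" "q \<in> ?h (Do (Out f) # k)"
        using q by (simp_all add: ctls_def)
      then show ?thesis by blast
    next
      case (OutW f k)
      then have "Do (Out f) # k \<in> ?S" "q \<in> ?h (Do (Out f) # k)"
        using q by (simp_all add: ctls_def)
      then show ?thesis by blast
    qed (use q in \<open>auto simp: ctls_def Let_def\<close>)
  qed
  moreover have "finite ?B"
    using S by (auto split: list.splits com.splits act.splits)
  ultimately show ?thesis by (rule finite_subset)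
qed

lemma delta_ctls:
  assumes "q \<in> ctls c"
  shows "fst (delta c q a) \<in> ctls c"
proof -
  define S where "S = insert [] (conts c [])"
  have cl: "succs l \<subseteq> S" if "l \<in> S" for l
    using that succs_conts[of l c "[]"] unfolding S_def by auto
  have c: "[c] \<in> S" "[] \<in> S" by (simp_all add: S_def conts_start)
  show ?thesis
  proof (cases q)
    case (Run k)
    then have "k \<in> S" using assms by (simp add: ctls_def S_def[symmetric])
    then show ?thesis using cl[of k] c unfolding ctls_def S_def[symmetric] Let_def Run
      by (cases "(c, Run k, a)" rule: delta.cases) simp_all
  qed (use assms c in \<open>simp_all add: ctls_def S_def[symmetric] Let_def\<close>)
qed

lemma delta_less: "a < 5832 \<Longrightarrow> fst (snd (delta c q a)) < 5832"
proof -
  assume a: "a < 5832"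
  have "c_out a < 5832" by (rule less_trans[OF c_less(2)]) simp
  then show ?thesis using a
    by (cases "(c, q, a)" rule: delta.cases) (auto intro!: cell_less)
qed

lemma tm_of_com:
  "\<exists>M. tm_wf M \<and> (\<forall>w n t h. reach c n (Ini, rd w, 0) (Hlt, t, h) \<longrightarrow>
     tm_computes_within M n w (tape_out t))"
proof -
  let ?Q = "ctls c"
  have ini: "Ini \<in> ?Q" "Hlt \<in> ?Q" by (auto simp: ctls_def)
  have fQ: "finite (?Q - {Ini, Hlt})" using finite_ctls by blast
  obtain g where g: "bij_betw g (?Q - {Ini, Hlt}) {0..<card (?Q - {Ini, Hlt})}"
    using ex_bij_betw_finite_nat[OF fQ] by blast
  \<comment> \<open>The machine model fixes 0 as initial and 1 as halting state.\<close>
  define e where "e q = (if q = Ini then 0 else if q = Hlt then 1 else g q + 2)" for q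
  define n where "n = card (?Q - {Ini, Hlt}) + 2"
  have inj: "inj_on e ?Q"
  proof (rule inj_onI)
    fix x y assume xy: "x \<in> ?Q" "y \<in> ?Q" "e x = e y"
    then have "x = y" if "x \<notin> {Ini, Hlt}" "y \<notin> {Ini, Hlt}"
      using that inj_onD[OF bij_betw_imp_inj_on[OF g], of x y] by (simp add: e_def)
    then show "x = y" using xy(3) by (auto simp: e_def split: if_splits)
  qed
  have lt: "e q < n" if "q \<in> ?Q" for q
    using bij_betwE[OF g] that unfolding e_def n_def by auto
  have sur: "\<exists>q\<in>?Q. e q = m" if "m < n" for m
  proof -
    consider "m = 0" | "m = 1" | "2 \<le> m" by linarith
    then show ?thesis
    proof cases
      case 3
      then have "m - 2 \<in> g ` (?Q - {Ini, Hlt})"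
        using that bij_betw_imp_surj_on[OF g] unfolding n_def by simp
      then obtain q where "q \<in> ?Q - {Ini, Hlt}" "g q = m - 2" by force
      then show ?thesis using 3 by (intro bexI[of _ q]) (auto simp: e_def)
    qed (use ini in \<open>auto simp: e_def\<close>)
  qed
  define d where "d m a = (case delta c (inv_into ?Q e m) a of (q, b, mv) \<Rightarrow> (e q, b, mv))" for m a
  define M where "M = TM n 5832 d"
  have wf: "tm_wf M"
    unfolding tm_wf_def M_def tm.sel
  proof (intro conjI allI impI)
    show "2 \<le> n" "(27::nat) \<le> 5832" by (simp_all add: n_def)
    fix q a :: nat assume qa: "q < n \<and> a < 5832"
    then have Q: "inv_into ?Q e q \<in> ?Q" using sur[of q] by (auto intro!: inv_into_into)
    show "case d q a of (q', b, m) \<Rightarrow> q' < n \<and> b < 5832"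
      using lt[OF delta_ctls[OF Q, of a]] delta_less[of a c "inv_into ?Q e q"] qa
      unfolding d_def by (auto split: prod.splits)
  qed
  have step: "tm_step M (e q, t, h) = (e q', t', h') \<and> q' \<in> ?Q"
    if "q \<in> ?Q" "cstep c (q, t, h) = (q', t', h')" for q t h q' t' h'
  proof -
    have "e q = 1 \<longleftrightarrow> q = Hlt" by (auto simp: e_def)
    then show ?thesis using that inv_into_f_f[OF inj that(1)] delta_ctls[OF that(1), of "t h"]
      by (auto simp: tm_step_def cstep_def M_def d_def split: prod.splits if_splits)
  qed
  have iter: "(tm_step M ^^ m) (e q, t, h) = (e q', t', h')"
    if "q \<in> ?Q" "(cstep c ^^ m) (q, t, h) = (q', t', h')" for q t h q' t' h' m
    using that
  proof (induction m arbitrary: q t h)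
    case (Suc m)
    obtain q1 t1 h1 where s: "cstep c (q, t, h) = (q1, t1, h1)" by (cases "cstep c (q, t, h)")
    have "(cstep c ^^ m) (q1, t1, h1) = (q', t', h')"
      using Suc.prems(2) s by (simp del: funpow.simps(2) add: funpow_Suc_right)
    then show ?case using Suc.IH[of q1 t1 h1] step[OF Suc.prems(1) s]
      by (simp del: funpow.simps(2) add: funpow_Suc_right)
  qed simp
  have "tm_computes_within M n w (tape_out t)" if r: "reach c n (Ini, rd w, 0) (Hlt, t, h)" for w n t h
  proof -
    obtain m where m: "m \<le> n" "(cstep c ^^ m) (Ini, rd w, 0) = (Hlt, t, h)"
      using r unfolding reach_iff by blast
    have "tm_init w = (e Ini, rd w, 0)" by (auto simp: tm_init_def e_def rd_def)
    then have "(tm_step M ^^ m) (tm_init w) = (e Hlt, t, h)" using iter[OF ini(1) m(2)] by simp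
    then show ?thesis using m(1) unfolding tm_computes_within_def
      by (intro exI[of _ m]) (simp add: e_def)
  qed
  then show ?thesis using wf by blast
qed

lemma com_polytime:
  "\<exists>M k d. tm_wf M \<and> (\<forall>w r s. sy w \<longrightarrow> ex c ([], w, None) r s \<longrightarrow>
     tm_computes_within M (k * (length w + 1) ^ d) w r)"
proof -
  obtain M where M: "tm_wf M" "\<And>w n t h. reach c n (Ini, rd w, 0) (Hlt, t, h) \<Longrightarrow>
     tm_computes_within M n w (tape_out t)" using tm_of_com[of c] by blast
  define m where "m = nconts c"
  \<comment> \<open>With \<open>z = length w + 1\<close>, at most \<open>2 * m * z ^ 2\<close> steps
    are simulated at a cost of at most \<open>(4 * m + 9) * z ^ 2\<close> each; the summand 6
    absorbs \<open>length w + 5\<close>.\<close>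
  have "tm_computes_within M ((2*m*(4*m + 9) + 6) * (length w + 1) ^ 4) w r"
    if w: "sy w" "ex c ([], w, None) r s" for w r s
  proof -
    obtain N t h where N: "N \<le> m * ((length w + 1) * (length w + 2))" "tape_out t = r"
      "reach c (N * (2 * length w + 2 * N + 6) + length w + N + 5) (Ini, rd w, 0) (Hlt, t, h)"
      using reach_total[OF w] unfolding m_def by blast
    define z where "z = length w + 1"
    have z1: "1 \<le> z" by (simp add: z_def)
    have zz: "1 \<le> z ^ 2" "z \<le> z ^ 2" using z1 by (auto simp: power2_eq_square)
    have "m * ((length w + 1) * (length w + 2)) \<le> m * (z * (2 * z))"
      by (intro mult_le_mono) (auto simp: z_def)
    then have N2: "N \<le> 2 * m * z ^ 2" using N(1) by (simp add: power2_eq_square algebra_simps)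
    have "2 * length w + 2 * N + 6 + 1 \<le> (4 * m + 9) * z ^ 2"
      using N2 zz by (simp add: z_def algebra_simps)
    then have "N * (2 * length w + 2 * N + 6 + 1) \<le> 2 * m * z ^ 2 * ((4 * m + 9) * z ^ 2)"
      using N2 by (rule mult_le_mono[rotated])
    moreover have "length w + 5 \<le> 6 * z ^ 2" using zz by (simp add: z_def)
    moreover have "z ^ 2 \<le> z ^ 4" using z1 by (simp add: power_increasing)
    ultimately have "N * (2 * length w + 2 * N + 6 + 1) + length w + 5
        \<le> 2 * m * z ^ 2 * ((4 * m + 9) * z ^ 2) + 6 * z ^ 4"
      by linarith
    also have "\<dots> = (2*m*(4*m + 9) + 6) * z ^ 4"
      by (simp add: algebra_simps power_add[symmetric])
    also have "N * (2 * length w + 2 * N + 6 + 1) + length w + 5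
        = N * (2 * length w + 2 * N + 6) + length w + N + 5"
      unfolding add_mult_distrib2[of N _ 1] by simp
    finally have "N * (2 * length w + 2 * N + 6) + length w + N + 5
        \<le> (2*m*(4*m + 9) + 6) * (length w + 1) ^ 4"
      unfolding z_def .
    from M(2)[OF reach_mono[OF N(3) this]] show ?thesis using N(2) by simp
  qed
  then show ?thesis using M(1) by blast
qed


section \<open>Scanning programs\<close>

text \<open>In a template, the symbol 0 stands for a copy of the number token being scanned.\<close>

fun sem :: "nat list \<Rightarrow> nat \<Rightarrow> nat list" where
  "sem [] x = []"
| "sem (c # cs) x = (if c = 0 then enc_nat x else [c]) @ sem cs x"

lemma sem_append [simp]: "sem (xs @ ys) x = sem xs x @ sem ys x"
  by (induction xs) auto

lemma sem_id: "set xs \<subseteq> {0<..<27} \<Longrightarrow> sem xs x = xs"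
  by (induction xs) auto

lemma enc_nat_digits: "\<exists>ds. enc_nat x = ds @ [3] \<and> set ds \<subseteq> {1, 2}"
proof (induction x rule: enc_nat.induct)
  case (1 n)
  show ?case
  proof (cases "n = 0")
    case True
    then show ?thesis by (simp add: enc_nat.simps)
  next
    case False
    then obtain ds where "enc_nat (n div 2) = ds @ [3]" "set ds \<subseteq> {1, 2}" using 1 by auto
    then show ?thesis using False
      by (subst enc_nat.simps) (auto intro!: exI[of _ "(if even n then 1 else 2) # ds"])
  qed
qed

lemma enc_nat_even: "0 < m \<Longrightarrow> enc_nat (2 * m) = 1 # enc_nat m"
  by (subst enc_nat.simps) simp

lemma enc_nat_odd: "enc_nat (Suc (2 * m)) = 2 # enc_nat m"
  by (subst enc_nat.simps) simp

lemma enc_nat_range [simp]: "set (enc_nat x) \<subseteq> {0<..<27}" "set (enc_nat x) \<subseteq> {..<27}"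
  using enc_nat_digits[of x] by (auto dest!: subsetD)

lemma enc_ph_term_range [simp]: "set (enc_ph_term t) \<subseteq> {0<..<27}"
  by (induction t) auto

lemma enc_ph_range [simp]: "set (enc_ph p) \<subseteq> {0<..<27}"
  by (induction p) auto

lemma range_weaken: "set xs \<subseteq> {0<..<27} \<Longrightarrow> set xs \<subseteq> {..<27}" for xs :: "nat list"
  by auto

lemma enc_range_weak [simp]: "set (enc_ph p) \<subseteq> {..<27}" "set (enc_ph_term t) \<subseteq> {..<27}"
  by (intro range_weaken enc_ph_range enc_ph_term_range)+

lemma sem_enc [simp]: "sem (enc_nat k) x = enc_nat k" "sem (enc_ph p) x = enc_ph p"
  "sem (enc_ph_term t) x = enc_ph_term t"
  by (rule sem_id, simp)+

text \<open>At the start of a token this lets \<open>copy_tok\<close> find its way back over the digits.\<close>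

definition gd :: "nat list \<Rightarrow> bool" where "gd u \<longleftrightarrow> u \<noteq> [] \<and> hd u \<notin> {1, 2}"

lemma gd_Cons [simp]: "gd (x # u) \<longleftrightarrow> x \<noteq> 1 \<and> x \<noteq> 2"
  by (auto simp: gd_def)

lemma gd_enc [simp]: "gd (rev (enc_nat x) @ u)"
  using enc_nat_digits[of x] by auto

section \<open>Moving over and copying number tokens\<close>

abbreviation tS :: "nat set \<Rightarrow> nat \<Rightarrow> bool \<Rightarrow> bool \<Rightarrow> bool" where
  "tS S \<equiv> \<lambda>x p l. x \<in> S"

lemma rd_Cons [simp]: "rd (x # v) 0 = x" "rd [] 0 = 0" by (simp_all add: rd_def)

lemma ex_SeqI: "ex c s r1 s1 \<Longrightarrow> ex d s1 r2 s2 \<Longrightarrow> r = r1 @ r2 \<Longrightarrow> ex (Seq c d) s r s2"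
  using ex_Seq by blast

lemma ex_LoopI: "test b s \<Longrightarrow> ex c s r1 s1 \<Longrightarrow> ex (Loop b c) s1 r2 s2 \<Longrightarrow> r = r1 @ r2
    \<Longrightarrow> ex (Loop b c) s r s2"
  using ex_LoopT by blast

lemma ex_MvR: "ex (Do MvR) (u, x # v, p) [] (x # u, v, p)"
  by (rule ex_Do) simp

lemma ex_MvL: "ex (Do MvL) (x # u, v, p) [] (u, x # v, p)"
  by (rule ex_Do) simp

lemma ex_Out: "0 < f \<Longrightarrow> f < 27 \<Longrightarrow> ex (Do (Out f)) s [f] s"
  by (rule ex_Do) simp

lemma ex_right:
  "set xs \<subseteq> S \<Longrightarrow> rd v 0 \<notin> S \<Longrightarrow> ex (Loop (tS S) (Do MvR)) (u, xs @ v, p) [] (rev xs @ u, v, p)"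
proof (induction xs arbitrary: u)
  case Nil
  then show ?case by (simp add: ex_LoopF test_def)
next
  case (Cons x xs)
  have "test (tS S) (u, x # xs @ v, p)" using Cons.prems by (simp add: test_def)
  from ex_LoopI[OF this ex_MvR Cons.IH[of "x # u"] refl] show ?case using Cons.prems by simp
qed

definition home :: com where "home = Loop (\<lambda>x p l. \<not> l) (Do MvL)"

lemma ex_home: "ex home (u, v, p) [] ([], rev u @ v, p)"
  unfolding home_def
proof (induction u arbitrary: v)
  case Nil
  then show ?case by (simp add: ex_LoopF test_def)
next
  case (Cons x u)
  have "test (\<lambda>x p l. \<not> l) (x # u, v, p)" by (simp add: test_def)
  from ex_LoopI[OF this ex_MvL Cons.IH[of "x # v"] refl] show ?case by simp
qed

definition to_pebble :: com where "to_pebble = Loop (\<lambda>x p l. \<not> p) (Do MvR)"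

lemma ex_to_pebble:
  "p = Some (length u + length xs) \<Longrightarrow> ex to_pebble (u, xs @ v, p) [] (rev xs @ u, v, p)"
  unfolding to_pebble_def
proof (induction xs arbitrary: u)
  case Nil
  then show ?case by (simp add: ex_LoopF test_def)
next
  case (Cons x xs)
  have "test (\<lambda>x p l. \<not> p) (u, x # xs @ v, p)" using Cons.prems by (simp add: test_def)
  from ex_LoopI[OF this ex_MvR Cons.IH[of "x # u"] refl] show ?case using Cons.prems by simp
qed

definition skip_tok :: com where "skip_tok = Seq (Loop (tS {1, 2}) (Do MvR)) (Do MvR)"

lemma ex_skip_tok: "ex skip_tok (u, enc_nat x @ v, p) [] (rev (enc_nat x) @ u, v, p)"
proof -
  obtain ds where ds: "enc_nat x = ds @ [3]" "set ds \<subseteq> {1, 2}" using enc_nat_digits by blast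
  then show ?thesis unfolding skip_tok_def
    using ex_SeqI[OF ex_right[of ds "{1,2}" "3 # v" u p] ex_MvR[of _ 3]] by simp
qed

text \<open>The head returns to the start of the token because a template may copy it several
  times.\<close>

definition copy_tok :: com where
  "copy_tok = Seq (Loop (tS {1, 2}) (Seq (Cond (tS {1}) (Do (Out 1)) (Do (Out 2))) (Do MvR)))
     (Seq (Do (Out 3)) (Seq (Do MvL) (Seq (Loop (tS {1, 2}) (Do MvL)) (Do MvR))))"

lemma ex_copy_digits:
  "set ds \<subseteq> {1, 2} \<Longrightarrow> rd v 0 \<notin> {1, 2} \<Longrightarrow>
    ex (Loop (tS {1, 2}) (Seq (Cond (tS {1}) (Do (Out 1)) (Do (Out 2))) (Do MvR)))
      (u, ds @ v, p) ds (rev ds @ u, v, p)"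
proof (induction ds arbitrary: u)
  case Nil
  then show ?case by (simp add: ex_LoopF test_def)
next
  case (Cons d ds)
  have "ex (Cond (tS {1}) (Do (Out 1)) (Do (Out 2))) (u, d # ds @ v, p) [d] (u, d # ds @ v, p)"
    using Cons.prems(1) ex_Out by (cases "d = 1") (auto intro: ex_CondT ex_CondF simp: test_def)
  then have "ex (Seq (Cond (tS {1}) (Do (Out 1)) (Do (Out 2))) (Do MvR)) (u, d # ds @ v, p) [d] (d # u, ds @ v, p)"
    by (rule ex_SeqI[OF _ ex_MvR]) simp
  moreover have "test (tS {1, 2}) (u, d # ds @ v, p)" using Cons.prems by (simp add: test_def)
  ultimately show ?case
    using ex_LoopI[OF _ _ Cons.IH[of "d # u"] refl] Cons.prems by fastforce
qed

lemma ex_left_digits: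
  "set ds \<subseteq> {1, 2} \<Longrightarrow> d \<in> {1, 2} \<Longrightarrow> y \<notin> {1, 2} \<Longrightarrow>
    ex (Loop (tS {1, 2}) (Do MvL)) (ds @ y # u, d # v, p) [] (u, y # rev ds @ d # v, p)"
proof (induction ds arbitrary: d v)
  case Nil
  show ?case
    by (rule ex_LoopI[OF _ _ ex_LoopF]) (use Nil ex_MvL in \<open>auto simp: test_def\<close>)
next
  case (Cons c ds)
  have "test (tS {1, 2}) (c # ds @ y # u, d # v, p)" using Cons.prems by (simp add: test_def)
  from ex_LoopI[OF this ex_MvL Cons.IH[of c "d # v"] refl] show ?case using Cons.prems by simp
qed

lemma ex_copy_tok:
  assumes "gd u"
  shows "ex copy_tok (u, enc_nat x @ v, p) (enc_nat x) (u, enc_nat x @ v, p)"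
proof -
  obtain y u' where u: "u = y # u'" "y \<notin> {1, 2}" using assms by (cases u) (auto simp: gd_def)
  obtain ds where ds: "enc_nat x = ds @ [3]" "set ds \<subseteq> {1, 2}" using enc_nat_digits by blast
  have "ex (Seq (Do MvL) (Seq (Loop (tS {1, 2}) (Do MvL)) (Do MvR)))
      (rev ds @ u, 3 # v, p) [] (u, ds @ 3 # v, p)"
  proof (cases ds rule: rev_cases)
    case Nil
    have "ex (Loop (tS {1, 2}) (Do MvL)) (u', y # 3 # v, p) [] (u', y # 3 # v, p)"
      by (rule ex_LoopF) (use u(2) in \<open>simp add: test_def\<close>)
    then show ?thesis using Nil u(1) by (auto intro!: ex_SeqI[OF ex_MvL ex_SeqI[OF _ ex_MvR]])
  next
    case (snoc es d)
    have "ex (Loop (tS {1, 2}) (Do MvL)) (rev es @ y # u', d # 3 # v, p) []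
        (u', y # rev (rev es) @ d # 3 # v, p)"
      by (rule ex_left_digits) (use u ds snoc in auto)
    then show ?thesis using snoc u(1) by (auto intro!: ex_SeqI[OF ex_MvL ex_SeqI[OF _ ex_MvR]])
  qed
  note 3 = this
  have 1: "ex (Loop (tS {1, 2}) (Seq (Cond (tS {1}) (Do (Out 1)) (Do (Out 2))) (Do MvR)))
      (u, ds @ 3 # v, p) ds (rev ds @ u, 3 # v, p)"
    by (rule ex_copy_digits) (use ds in auto)
  have 2: "ex (Do (Out 3)) (rev ds @ u, 3 # v, p) [3] (rev ds @ u, 3 # v, p)"
    by (rule ex_Out) auto
  show ?thesis unfolding copy_tok_def
    using ex_SeqI[OF 1 ex_SeqI[OF 2 3]] ds(1) by simp
qed

fun items :: "nat list \<Rightarrow> com" where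
  "items [] = Nop"
| "items (c # cs) = Seq (if c = 0 then copy_tok else Do (Out c)) (items cs)"

lemma ex_items:
  "set cs \<subseteq> {..<27} \<Longrightarrow> gd u \<Longrightarrow> ex (items cs) (u, enc_nat x @ v, p) (sem cs x) (u, enc_nat x @ v, p)"
proof (induction cs)
  case Nil
  then show ?case by (simp add: ex_Nop)
next
  case (Cons c cs)
  have "ex (if c = 0 then copy_tok else Do (Out c)) (u, enc_nat x @ v, p)
      (if c = 0 then enc_nat x else [c]) (u, enc_nat x @ v, p)"
    using Cons.prems ex_copy_tok ex_Out by simp
  then show ?case unfolding items.simps sem.simps
    by (rule ex_SeqI) (use Cons in auto)
qed

lemma ex_outs: "set cs \<subseteq> {0<..<27} \<Longrightarrow> ex (items cs) s cs s"
proof (induction cs)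
  case Nil
  then show ?case by (simp add: ex_Nop)
next
  case (Cons c cs)
  then show ?case by (auto intro!: ex_SeqI ex_Out)
qed

definition tok :: "nat list \<Rightarrow> com" where "tok cs = Seq (items cs) skip_tok"

lemma ex_tok:
  "set cs \<subseteq> {..<27} \<Longrightarrow> gd u \<Longrightarrow>
    ex (tok cs) (u, enc_nat x @ v, p) (sem cs x) (rev (enc_nat x) @ u, v, p)"
  unfolding tok_def using ex_SeqI[OF ex_items ex_skip_tok] by simp

abbreviation digit :: "nat set" where "digit \<equiv> {1, 2, 3}"

lemma rd_enc [simp]: "rd (enc_nat x @ v) 0 \<in> digit"
proof -
  obtain ds where ds: "enc_nat x = ds @ [3]" "set ds \<subseteq> {1, 2}" using enc_nat_digits by blast
  then show ?thesis by (cases ds) auto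
qed

text \<open>An entry begins with a symbol in \<open>digit\<close> and the closing bracket does not,
  which gives the exit test.\<close>

definition scan_edges :: "nat list \<Rightarrow> nat list \<Rightarrow> com" where
  "scan_edges A B = Loop (tS digit) (Seq (tok A) (tok B))"

definition enc_edge :: "nat \<times> nat \<Rightarrow> nat list" where
  "enc_edge = (\<lambda>(a, b). enc_nat a @ enc_nat b)"

definition sem_edge :: "nat list \<Rightarrow> nat list \<Rightarrow> nat \<times> nat \<Rightarrow> nat list" where
  "sem_edge A B e = sem A (fst e) @ sem B (snd e)"

lemma ex_scan_edges:
  assumes "set A \<subseteq> {..<27}" "set B \<subseteq> {..<27}" "rd v 0 \<notin> digit"
  shows "gd u \<Longrightarrow> ex (scan_edges A B) (u, concat (map enc_edge E) @ v, p)
    (concat (map (sem_edge A B) E)) (rev (concat (map enc_edge E)) @ u, v, p)"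
  unfolding scan_edges_def
proof (induction E arbitrary: u)
  case Nil
  then show ?case using assms by (simp add: ex_LoopF test_def)
next
  case (Cons e E)
  obtain a b where e: "e = (a, b)" by (cases e)
  let ?v = "concat (map enc_edge E) @ v"
  have "ex (Seq (tok A) (tok B)) (u, enc_nat a @ enc_nat b @ ?v, p) (sem A a @ sem B b)
      (rev (enc_nat b) @ rev (enc_nat a) @ u, ?v, p)"
    by (rule ex_SeqI[OF ex_tok ex_tok]) (use assms Cons.prems in auto)
  moreover have "test (tS digit) (u, enc_nat a @ enc_nat b @ ?v, p)"
    unfolding test_def prod.case by (rule rd_enc)
  ultimately have "ex (Loop (tS digit) (Seq (tok A) (tok B))) (u, enc_nat a @ enc_nat b @ ?v, p)
      ((sem A a @ sem B b) @ concat (map (sem_edge A B) E))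
      (rev (concat (map enc_edge E)) @ rev (enc_nat b) @ rev (enc_nat a) @ u, v, p)"
    using ex_LoopI[OF _ _ Cons.IH refl] gd_enc by blast
  moreover have "enc_edge e = enc_nat a @ enc_nat b" "sem_edge A B e = sem A a @ sem B b"
    by (simp_all add: e enc_edge_def sem_edge_def)
  ultimately show ?case by simp
qed

definition scan_toks :: "nat list \<Rightarrow> com" where
  "scan_toks Q = Loop (tS digit) (tok Q)"

lemma ex_scan_toks:
  assumes "set Q \<subseteq> {..<27}" "rd v 0 \<notin> digit"
  shows "gd u \<Longrightarrow> ex (scan_toks Q) (u, concat (map enc_nat l) @ v, p)
    (concat (map (sem Q) l)) (rev (concat (map enc_nat l)) @ u, v, p)"
  unfolding scan_toks_def
proof (induction l arbitrary: u)
  case Nil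
  then show ?case using assms by (simp add: ex_LoopF test_def)
next
  case (Cons q l)
  let ?v = "concat (map enc_nat l) @ v"
  have "ex (tok Q) (u, enc_nat q @ ?v, p) (sem Q q) (rev (enc_nat q) @ u, ?v, p)"
    by (rule ex_tok) (use assms Cons.prems in auto)
  moreover have "test (tS digit) (u, enc_nat q @ ?v, p)"
    unfolding test_def prod.case by (rule rd_enc)
  ultimately have "ex (Loop (tS digit) (tok Q)) (u, enc_nat q @ ?v, p)
      (sem Q q @ concat (map (sem Q) l)) (rev (concat (map enc_nat l)) @ rev (enc_nat q) @ u, v, p)"
    using ex_LoopI[OF _ _ Cons.IH refl] gd_enc by blast
  then show ?case by simp
qed

definition scan_labels :: "nat list \<Rightarrow> nat list \<Rightarrow> nat list \<Rightarrow> com" where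
  "scan_labels C Q D = Loop (tS {6})
     (Seq (items C) (Seq (Do MvR) (Seq (scan_toks Q) (Seq (items D) (Do MvR)))))"

definition sem_label :: "nat list \<Rightarrow> nat list \<Rightarrow> nat list \<Rightarrow> nat list \<Rightarrow> nat list" where
  "sem_label C Q D l = C @ concat (map (sem Q) l) @ D"

lemma ex_scan_labels:
  assumes "set C \<subseteq> {0<..<27}" "set Q \<subseteq> {..<27}" "set D \<subseteq> {0<..<27}" "rd v 0 \<noteq> 6"
  shows "ex (scan_labels C Q D) (u, concat (map (enc_list enc_nat) ls) @ v, p)
    (concat (map (sem_label C Q D) ls)) (rev (concat (map (enc_list enc_nat) ls)) @ u, v, p)"
  unfolding scan_labels_def
proof (induction ls arbitrary: u)
  case Nil
  then show ?case using assms by (simp add: ex_LoopF test_def)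
next
  case (Cons l ls)
  let ?v = "concat (map (enc_list enc_nat) ls) @ v" and ?l = "concat (map enc_nat l)"
  have s: "ex (scan_toks Q) (6 # u, ?l @ 7 # ?v, p) (concat (map (sem Q) l)) (rev ?l @ 6 # u, 7 # ?v, p)"
    by (rule ex_scan_toks) (use assms in auto)
  have b: "ex (Seq (items C) (Seq (Do MvR) (Seq (scan_toks Q) (Seq (items D) (Do MvR)))))
      (u, 6 # ?l @ 7 # ?v, p) (sem_label C Q D l) (7 # rev ?l @ 6 # u, ?v, p)"
    by (rule ex_SeqI[OF ex_outs[OF assms(1)] ex_SeqI[OF ex_MvR ex_SeqI[OF s
        ex_SeqI[OF ex_outs[OF assms(3)] ex_MvR]]]]) (auto simp: sem_label_def)
  have t: "test (tS {6}) (u, 6 # ?l @ 7 # ?v, p)" by (simp add: test_def)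
  from ex_LoopI[OF t b Cons.IH refl] show ?case
    using enc_list_def[of enc_nat l] by simp
qed

text \<open>A pass sweeps once over the structure. It applies a template to the initial state, two
  templates to each edge, and to each label set a prefix, a template per label and a suffix.\<close>

datatype pass = Pass "nat list" "nat list" "nat list" "nat list" "nat list" "nat list"

fun pass_com :: "pass \<Rightarrow> com" where
  "pass_com (Pass I A B C Q D) = Seq home (Seq skip_tok (Seq (tok I) (Seq (Do MvR)
     (Seq (scan_edges A B) (Seq (Do MvR) (Seq (Do MvR) (Seq (scan_labels C Q D) (Do MvR))))))))"

fun pass_sem :: "kripke \<Rightarrow> pass \<Rightarrow> nat list" where
  "pass_sem K (Pass I A B C Q D) = sem I (ks_init K) @ concat (map (sem_edge A B) (ks_edges K))
     @ concat (map (sem_label C Q D) (ks_labels K))"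

fun pass_ok :: "pass \<Rightarrow> bool" where
  "pass_ok (Pass I A B C Q D) \<longleftrightarrow> set I \<subseteq> {..<27} \<and> set A \<subseteq> {..<27} \<and> set B \<subseteq> {..<27}
     \<and> set C \<subseteq> {0<..<27} \<and> set Q \<subseteq> {..<27} \<and> set D \<subseteq> {0<..<27}"

text \<open>A pass may start anywhere, since it first walks to the left end. It always ends just
  behind the structure, so passes can be chained.\<close>

lemma ex_pass:
  assumes ok: "pass_ok P" and uv: "rev u @ v = enc_kripke K @ fs"
  shows "ex (pass_com P) (u, v, p) (pass_sem K P) (rev (enc_kripke K), fs, p)"
proof -
  obtain I A B C Q D where P: "P = Pass I A B C Q D" by (cases P)
  let ?E = "concat (map enc_edge (ks_edges K))" and ?L = "concat (map (enc_list enc_nat) (ks_labels K))"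
  let ?n = "enc_nat (ks_n K)" and ?i = "enc_nat (ks_init K)"
  let ?v4 = "?L @ 7 # fs"
  let ?u4 = "6 # 7 # rev ?E @ 6 # rev ?i @ rev ?n"
  have K: "enc_kripke K = ?n @ ?i @ 6 # ?E @ 7 # 6 # ?L @ [7]"
    by (simp add: enc_kripke_def enc_list_def enc_edge_def)
  have 1: "ex home (u, v, p) [] ([], ?n @ ?i @ 6 # ?E @ 7 # 6 # ?v4, p)"
    using ex_home[of u v p] uv K by simp
  have 2: "ex skip_tok ([], ?n @ ?i @ 6 # ?E @ 7 # 6 # ?v4, p) [] (rev ?n, ?i @ 6 # ?E @ 7 # 6 # ?v4, p)"
    using ex_skip_tok[of "[]"] by simp
  have 3: "ex (tok I) (rev ?n, ?i @ 6 # ?E @ 7 # 6 # ?v4, p) (sem I (ks_init K))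
      (rev ?i @ rev ?n, 6 # ?E @ 7 # 6 # ?v4, p)"
    by (rule ex_tok) (use ok P gd_enc[of _ "[]"] in auto)
  have 4: "ex (scan_edges A B) (6 # rev ?i @ rev ?n, ?E @ 7 # 6 # ?v4, p)
      (concat (map (sem_edge A B) (ks_edges K))) (rev ?E @ 6 # rev ?i @ rev ?n, 7 # 6 # ?v4, p)"
    by (rule ex_scan_edges) (use ok P in auto)
  have 5: "ex (scan_labels C Q D) (?u4, ?v4, p) (concat (map (sem_label C Q D) (ks_labels K)))
      (rev ?L @ ?u4, 7 # fs, p)"
    by (rule ex_scan_labels) (use ok P in auto)
  have "rev (enc_kripke K) = 7 # rev ?L @ ?u4" using K by simp
  then show ?thesis unfolding P pass_com.simps
    by (simp only:) (rule ex_SeqI[OF 1 ex_SeqI[OF 2 ex_SeqI[OF 3 ex_SeqI[OF ex_MvR ex_SeqI[OF 4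
      ex_SeqI[OF ex_MvR ex_SeqI[OF ex_MvR ex_SeqI[OF 5 ex_MvR]]]]]]]]; simp)
qed

fun passes_com :: "pass list \<Rightarrow> com" where
  "passes_com [] = Nop"
| "passes_com (P # Ps) = Seq (pass_com P) (passes_com Ps)"

lemma ex_passes:
  "list_all pass_ok Ps \<Longrightarrow> ex (passes_com Ps) (rev (enc_kripke K), fs, p)
    (concat (map (pass_sem K) Ps)) (rev (enc_kripke K), fs, p)"
proof (induction Ps)
  case Nil
  then show ?case by (simp add: ex_Nop)
next
  case (Cons P Ps)
  then show ?case by (auto intro!: ex_SeqI[OF ex_pass])
qed

text \<open>Serves to bring the head behind the structure without output.\<close>

definition nil_pass :: pass where "nil_pass = Pass [] [] [] [] [] []"

lemma sem_nil [simp]: "concat (map (sem_edge [] []) E) = []" "concat (map (sem_label [] [] []) ls) = []"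
  by (auto simp: sem_edge_def sem_label_def)

text \<open>The pebble keeps the place in the formula. It lies to the right of the structure, so a
  search to the right finds it, and one pebble is enough because macros do not nest.\<close>

definition macro :: "pass list \<Rightarrow> com" where
  "macro Ps = Seq (Do SetP) (Seq (pass_com nil_pass) (Seq (passes_com Ps) (Seq to_pebble (Do ClrP))))"

lemma ex_macro:
  assumes "list_all pass_ok Ps" "u = u' @ rev (enc_kripke K)"
  shows "ex (macro Ps) (u, v, None) (concat (map (pass_sem K) Ps)) (u, v, None)"
proof -
  let ?p = "Some (length u)"
  have 1: "ex (Do SetP) (u, v, None) [] (u, v, ?p)" by (rule ex_Do) simp
  have "pass_ok nil_pass" by (simp add: nil_pass_def)
  from ex_pass[OF this, of u v K "rev u' @ v" ?p]
  have 2: "ex (pass_com nil_pass) (u, v, ?p) [] (rev (enc_kripke K), rev u' @ v, ?p)"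
    using assms(2) by (simp add: nil_pass_def)
  have 3: "ex to_pebble (rev (enc_kripke K), rev u' @ v, ?p) [] (u, v, ?p)"
    using ex_to_pebble[of ?p "rev (enc_kripke K)" "rev u'" v] assms(2) by simp
  have 4: "ex (Do ClrP) (u, v, ?p) [] (u, v, None)" by (rule ex_Do) simp
  show ?thesis unfolding macro_def
    by (rule ex_SeqI[OF 1 ex_SeqI[OF 2 ex_SeqI[OF ex_passes[OF assms(1)] ex_SeqI[OF 3 4]]]]; simp)
qed


section \<open>The reduction as a program\<close>

abbreviation n :: "nat \<Rightarrow> nat list" where "n \<equiv> enc_nat"

text \<open>Working on symbol lists, these build templates as well as finished encodings, and
  \<open>sem\<close> commutes with them.\<close>

definition tV :: "nat list \<Rightarrow> nat list" where "tV x = 20 # n 1 @ x"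
definition tEq :: "nat list \<Rightarrow> nat list \<Rightarrow> nat list" where
  "tEq x t = 26 # x @ n vE @ 23 # 22 # t @ tV (n vE)"
definition tExEq :: "nat list \<Rightarrow> nat list \<Rightarrow> nat list" where
  "tExEq x t = 25 # x @ 24 # tEq x t"

text \<open>Templates for \<open>blk d a\<close>, \<open>th a\<close> and \<open>PConst a\<close>, where \<open>a\<close> is the scanned token.\<close>

definition tB :: "nat \<Rightarrow> nat list" where
  "tB d = [1, if odd d then 2 else 1, if odd (d div 2) then 2 else 1, if odd (d div 4) then 2 else 1,
     1, 1, 2, 0]"
definition tT :: "nat list" where "tT = [2, 0]"
definition tC :: "nat list" where "tC = [19, 0]"

lemma enc_nat_bit: "0 < m \<Longrightarrow> b \<le> 1 \<Longrightarrow> n (2 * m + b) = (if odd b then 2 else 1) # n m"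
proof -
  assume "0 < m" "b \<le> 1"
  then have "b = 0 \<or> b = 1" by auto
  then show ?thesis using enc_nat_even[OF \<open>0 < m\<close>] enc_nat_odd[of m] by auto
qed

text \<open>From the least significant end: a 0 for evenness, three bits of \<open>d\<close>, two
  zeros, the 1 of the summand 64, then \<open>a\<close>. That 1 is needed for \<open>a = 0\<close>,
  whose encoding has no digits and would otherwise cut off the zeros below it.\<close>

lemma sem_tB [simp]: "d < 8 \<Longrightarrow> sem (tB d) a = n (blk d a)"
proof -
  assume d: "d < 8"
  define x y z where "x = d mod 2" and "y = d div 2 mod 2" and "z = d div 4"
  have b: "x \<le> 1" "y \<le> 1" "z \<le> 1" using d by (auto simp: x_def y_def z_def)
  have dd: "d = x + 2 * y + 4 * z"
  proof -
    have "d div 4 = d div 2 div 2" using div_mult2_eq[of d 2 2] by simp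
    then show ?thesis
      using div_mult_mod_eq[of d 2] div_mult_mod_eq[of "d div 2" 2]
      unfolding x_def y_def z_def by linarith
  qed
  have o: "odd x = odd d" "odd y = odd (d div 2)" "odd z = odd (d div 4)"
    by (auto simp: x_def y_def z_def)
  define q where "q = 2 * a + 1"
  have q: "0 < q" "n q = 2 # n a" using enc_nat_odd[of a] by (simp_all add: q_def)
  have "blk d a = 2 * (2 * (2 * (2 * (2 * (2 * q + 0) + 0) + z) + y) + x) + 0"
    unfolding blk_def q_def by (subst dd) simp
  also have "n \<dots> = 1 # (if odd x then 2 else 1) # (if odd y then 2 else 1) # (if odd z then 2 else 1)
      # 1 # 1 # n q"
    using b q(1) by (subst enc_nat_bit, simp, simp)+ simp
  finally show ?thesis unfolding q(2) by (simp add: tB_def o)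
qed

lemma sem_tT [simp]: "sem tT x = n (th x)"
  using enc_nat_odd[of x] by (simp add: tT_def th_def)

lemma sem_templates [simp]:
  "sem tC x = enc_ph_term (PConst x)"
  "sem (tV xs) x = tV (sem xs x)" "sem (tEq xs t) x = tEq (sem xs x) (sem t x)"
  "sem (tExEq xs t) x = tExEq (sem xs x) (sem t x)"
  by (simp_all add: tC_def tV_def tEq_def tExEq_def)

lemma enc_ph_derived [simp]:
  "enc_ph_term (PMul (Suc 0) x) = tV (n x)"
  "enc_ph (POr p q) = 23 # 24 # 23 # enc_ph p @ 23 # enc_ph q"
  "enc_ph (PEq x t) = tEq (n x) (enc_ph_term t)"
  "enc_ph (PExEq x t p) = tExEq (n x) (enc_ph_term t) @ enc_ph p"
  by (simp_all add: POr_def PEq_def PExEq_def tV_def tEq_def tExEq_def)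

declare enc_ph_term.simps(2) [simp del]

section \<open>Templates for the pieces of the translation\<close>

abbreviation lit :: "nat list \<Rightarrow> pass" where "lit s \<equiv> Pass s [] [] [] [] []"
abbreviation edge_pass :: "nat list \<Rightarrow> nat list \<Rightarrow> pass" where "edge_pass A B \<equiv> Pass [] A B [] [] []"

abbreviation em :: "kripke \<Rightarrow> pass list \<Rightarrow> nat list" where
  "em K Ps \<equiv> concat (map (pass_sem K) Ps)"

text \<open>The final 23 is the negation in front of the second disjunct. Hence the texts of all
  edges, followed by that of \<open>PFalse\<close>, form the whole nested disjunction.\<close>

definition look_t :: "nat \<Rightarrow> nat list" where
  "look_t d = 23 # 24 # 23 # 24 # tEq (n vS) tC @ 24 # tEq (n vF) (tV (tB d))
     @ 24 # tEq (n vG) (tV (tB (Suc d))) @ tEq (n vP) (tV (tB (Suc (Suc d)))) @ [23]"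

lemma enc_look: "d \<le> 5 \<Longrightarrow> enc_ph (look d E) = concat (map (sem_edge (look_t d) []) E) @ enc_ph PFalse"
  by (induction E) (simp_all add: look_t_def sem_edge_def)

definition mul_t :: "nat list" where
  "mul_t = 23 # 24 # 23 # enc_ph (PLe (PAdd (V vP) (V vY)) (PConst 0)) @ 23 # 25 # n vU
     @ 24 # enc_ph (PEq vP (PAdd (V vU) (PConst 1))) @ 25 # n vW
     @ 24 # enc_ph (PEq vY (PAdd (V vW) (V vK))) @ tExEq (n vP) (tV (n vU)) @ tExEq (n vY) (tV (n vW))"

lemma enc_mul: "enc_ph (mulF E) = concat (map (sem_edge mul_t []) E)
    @ enc_ph (PLe (PAdd (V vP) (V vY)) (PConst 0))"
  by (induction E) (simp_all add: mul_t_def sem_edge_def)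

definition St_p :: "nat \<Rightarrow> pass list" where
  "St_p d = [lit (25 # n vF @ 25 # n vG @ 25 # n vP @ [24]), edge_pass (look_t d) [],
     lit (enc_ph PFalse @ 25 # n vK @ 25 # n vY @ 24 # enc_ph (PEq vJ (PAdd (V vF) (V vY)))
       @ 24 # enc_ph (PNot (PAnd (PLe (PConst 1) (V vG)) (PLe (V vG) (V vJ))))),
     edge_pass mul_t [], lit (enc_ph (PLe (PAdd (V vP) (V vY)) (PConst 0)))]"

lemma enc_St: "d \<le> 5 \<Longrightarrow> enc_ph (St d (ks_edges K)) = em K (St_p d)"
  by (simp add: St_def St_p_def enc_look enc_mul)

definition edge_t :: "nat list" where "edge_t = 23 # 24 # 23 # 24 # tEq (n vS) tC"
definition edge_t' :: "nat list" where "edge_t' = tEq (n vT) tC @ [23]"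

lemma enc_edgeF: "enc_ph (edgeF E) = concat (map (sem_edge edge_t edge_t') E) @ enc_ph PFalse"
  by (induction E) (simp_all add: edge_t_def edge_t'_def sem_edge_def)

definition init_p :: "pass list" where "init_p = lit (tExEq (n vS) tC) # St_p 0"

lemma enc_initF: "enc_ph (initF (ks_edges K) (ks_init K)) = em K init_p"
  by (simp add: initF_def init_p_def enc_St)

definition valid_p :: "pass list" where
  "valid_p = lit (24 # tExEq (n vJ) (enc_ph_term (PConst 0))) # init_p
     @ lit (24 # 23 # 25 # n vJ @ 23 # tExEq (n vO) (enc_ph_term (PConst 1)) @ 26 # n vO @ n vS) # St_p 0
     @ lit (23 # 25 # n vJ @ 23 # 25 # n vS @ [24]) # St_p 0
     @ lit (25 # n vT @ [24]) # edge_pass edge_t edge_t'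
     # lit (enc_ph PFalse @ tExEq (n vU) (enc_ph_term (PAdd (V vJ) (PConst 1)))
         @ tExEq (n vJ) (tV (n vU)) @ tExEq (n vS) (tV (n vT))) # St_p 0"

lemma enc_validF: "enc_ph (validF (ks_edges K) (ks_init K)) = em K valid_p"
  by (simp add: validF_def valid_p_def enc_St enc_initF enc_edgeF)

definition agree_p :: "pass list" where
  "agree_p = lit (23 # 25 # n vJ @ 24 # enc_ph (PLe (V vJ) (V vI)) @ 25 # n vS @ [24]) # St_p 0
     @ lit [23] # St_p 3"

lemma enc_agreeF: "enc_ph (agreeF (ks_edges K)) = em K agree_p"
  by (simp add: agreeF_def agree_p_def enc_St)

definition exz_t :: "nat list" where "exz_t = 25 # tB 0 @ 25 # tB 1 @ 25 # tB 2"

lemma enc_exz: "enc_ph (exz E p) = concat (map (sem_edge exz_t []) E) @ enc_ph p"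
  by (induction E) (simp_all add: exz_t_def sem_edge_def)

definition sav_t :: "nat list" where
  "sav_t = tExEq (tB 3) (tV (tB 0)) @ tExEq (tB 4) (tV (tB 1)) @ tExEq (tB 5) (tV (tB 2))"

lemma enc_sav: "enc_ph (sav E p) = concat (map (sem_edge sav_t []) E) @ enc_ph p"
  by (induction E) (simp_all add: sav_t_def sem_edge_def)

definition lab_pass :: pass where
  "lab_pass = Pass (25 # n vQ @ [24]) [] [] (23 # 24 # 23 # 24 # enc_ph (PEq vS (PConst 0)))
     (23 # 24 # 23 # tEq (n vQ) tC @ [23])
     (enc_ph PFalse @ 23 # 25 # n vU @ 24 # enc_ph (PEq vS (PAdd (V vU) (PConst 1))) @ tExEq (n vS) (tV (n vU)))"

lemma enc_memF: "enc_ph (memF l) = concat (map (sem (23 # 24 # 23 # tEq (n vQ) tC @ [23])) l) @ enc_ph PFalse"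
  by (induction l) simp_all

lemma enc_labF: "25 # n vQ @ 24 # enc_ph (labF (ks_labels K)) = pass_sem K lab_pass @ enc_ph PFalse"
proof -
  have "enc_ph (labF ls) = concat (map (sem_label (23 # 24 # 23 # 24 # enc_ph (PEq vS (PConst 0)))
     (23 # 24 # 23 # tEq (n vQ) tC @ [23])
     (enc_ph PFalse @ 23 # 25 # n vU @ 24 # enc_ph (PEq vS (PAdd (V vU) (PConst 1)))
       @ tExEq (n vS) (tV (n vU)))) ls) @ enc_ph PFalse" for ls
    by (induction ls) (simp_all add: sem_label_def enc_memF)
  then show ?thesis by (simp add: lab_pass_def)
qed

definition cap_p :: "pass list" where
  "cap_p = lit (tExEq (n vJ) (tV (n vI)) @ 25 # n vS @ [24]) # St_p 0 @ [lab_pass, lit (enc_ph PFalse)]"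

definition ce_p :: "pass list" where
  "ce_p = edge_pass sav_t [] # edge_pass exz_t [] # lit [24] # valid_p @ lit [24] # agree_p"

definition top_p :: "pass list" where
  "top_p = edge_pass exz_t [] # lit [24] # valid_p
     @ lit (25 # n vI @ 24 # tExEq (n vJ) (tV (n vI))) # init_p"

definition until_t :: "nat list" where
  "until_t = tExEq (n vO) (tV (n vI)) @ 25 # n vI @ 24 # enc_ph (PLe (V vO) (V vI))
     @ 24 # 23 # 25 # n vJ @ 24 # enc_ph (PLe (V vO) (V vJ))
     @ 24 # enc_ph (PLe (PAdd (V vJ) (PConst 1)) (V vI)) @ 23 # tExEq (n vI) (tV (n vJ))"

definition next_t :: "nat list" where
  "next_t = tExEq (n vJ) (enc_ph_term (PAdd (V vI) (PConst 1))) @ tExEq (n vI) (tV (n vJ))"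

definition le_t :: "nat list" where
  "le_t = 25 # n vA @ 25 # n vB @ 25 # n vM @ 25 # n vN
     @ 24 # enc_ph (PLe (PAdd (V vA) (V vN)) (PAdd (V vM) (V vB)))
     @ 24 # tExEq (n vM) (tV (n vA)) @ tExEq (n vN) (tV (n vB))"

definition add_t :: "nat list" where
  "add_t = 25 # n vA @ 25 # n vB @ 25 # n vC @ 25 # n vD
     @ 24 # enc_ph (PLe (PAdd (V vM) (PAdd (V vB) (V vD))) (PAdd (V vN) (PAdd (V vA) (V vC))))
     @ 24 # enc_ph (PLe (PAdd (V vN) (PAdd (V vA) (V vC))) (PAdd (V vM) (PAdd (V vB) (V vD))))
     @ tExEq (n vM) (tV (n vC)) @ tExEq (n vN) (tV (n vD))
     @ 24 # tExEq (n vM) (tV (n vA)) @ tExEq (n vN) (tV (n vB))"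

definition const_t :: "bool \<Rightarrow> nat list" where
  "const_t s = (if s then tEq (n vM) (21 # tV (n vN) @ tC) else tEq (n vN) (21 # tV (n vM) @ tC))"

text \<open>A template sees one token only. The coefficient and the counting variable are separate
  tokens, so the text is split between \<open>count_t\<close> and \<open>count_t'\<close>.\<close>

definition count_t :: "bool \<Rightarrow> nat list" where
  "count_t s = 25 # n vC @ 24 # (if s then tEq (n vM) (21 # tV (n vN) @ 20 # 0 # n vC)
     else tEq (n vN) (21 # tV (n vM) @ 20 # 0 # n vC))"

definition count_t' :: "nat list" where
  "count_t' = 26 # n vC @ n vJ @ 24 # 22 # tV tT @ tV (n vJ) @ 24 # enc_ph (PLe (V vJ) (V vI))
     @ tExEq (n vI) (tV (n vJ))"

definition zero_t :: "nat list" where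
  "zero_t = 24 # 22 # tV tT @ enc_ph_term (PConst 0)"

lemma enc_tr:
  "enc_ph (tr K (CAP p)) = em K cap_p @ sem (tEq (n vQ) tC) p"
  "enc_ph (tr K (CX f)) = next_t @ enc_ph (tr K f)"
  "enc_ph (tr K (CU f g)) = until_t @ enc_ph (tr K f) @ enc_ph (tr K g)"
  "enc_ph (tr K (CE f)) = em K ce_p @ enc_ph (tr K f)"
  "enc_ph (tr K (CBind x f)) = sem (tExEq tT (tV (n vI))) x @ enc_ph (tr K f)"
  "enc_ph (tr K (CLe s t)) = le_t @ enc_ph (trv K s) @ enc_ph (trv K t)"
  "enc_ph (trv K (CConst a)) = sem (const_t (0 \<le> a)) (nat \<bar>a\<bar>)"
  "enc_ph (trv K (CCount a x f)) = sem (count_t (0 \<le> a)) (nat \<bar>a\<bar>) @ sem count_t' x @ enc_ph (tr K f)"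
  "enc_ph (trv K (CAdd s t)) = add_t @ enc_ph (trv K s) @ enc_ph (trv K t)"
          apply (simp_all add: next_t_def until_t_def le_t_def const_t_def count_t_def count_t'_def add_t_def)
    apply (simp add: cap_p_def enc_St enc_labF[simplified])
   apply (simp add: ce_p_def enc_sav enc_exz enc_validF enc_agreeF)
  apply (simp add: enc_ph_term.simps(2))
  done

lemma enc_red:
  "enc_ph (red K f) = concat (map (sem zero_t) (toks f)) @ em K top_p @ enc_ph (tr K f)"
proof -
  have z: "enc_ph (zeroF xs p) = concat (map (sem zero_t) xs) @ enc_ph p" for xs p
    by (induction xs) (simp_all add: zero_t_def)
  show ?thesis unfolding red_def z by (simp add: top_p_def enc_exz enc_validF enc_initF)
qed

lemma template_range [simp]:
  "set tT \<subseteq> {..<27}" "set tC \<subseteq> {..<27}" "set (tB d) \<subseteq> {..<27}"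
  "set (tV x) \<subseteq> {..<27} \<longleftrightarrow> set x \<subseteq> {..<27}"
  "set (tEq x t) \<subseteq> {..<27} \<longleftrightarrow> set x \<subseteq> {..<27} \<and> set t \<subseteq> {..<27}"
  "set (tExEq x t) \<subseteq> {..<27} \<longleftrightarrow> set x \<subseteq> {..<27} \<and> set t \<subseteq> {..<27}"
  "set (tV x) \<subseteq> {0<..<27} \<longleftrightarrow> set x \<subseteq> {0<..<27}"
  "set (tEq x t) \<subseteq> {0<..<27} \<longleftrightarrow> set x \<subseteq> {0<..<27} \<and> set t \<subseteq> {0<..<27}"
  "set (tExEq x t) \<subseteq> {0<..<27} \<longleftrightarrow> set x \<subseteq> {0<..<27} \<and> set t \<subseteq> {0<..<27}"
  by (simp_all add: tT_def tC_def tB_def tV_def tEq_def tExEq_def conj_commute)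

lemma pass_ok_St: "list_all pass_ok (St_p d)"
  by (simp add: St_p_def look_t_def mul_t_def)

lemma pass_ok_init: "list_all pass_ok init_p"
  by (simp add: init_p_def pass_ok_St)

lemma pass_ok_valid: "list_all pass_ok valid_p"
  by (simp add: valid_p_def pass_ok_St pass_ok_init edge_t_def edge_t'_def)

lemma pass_ok_macros: "list_all pass_ok cap_p" "list_all pass_ok ce_p" "list_all pass_ok top_p"
  by (simp_all add: cap_p_def ce_p_def top_p_def pass_ok_St pass_ok_valid pass_ok_init agree_p_def
      sav_t_def exz_t_def lab_pass_def)


section \<open>The translation loop\<close>

lemma ex_Cond_iff [simp]:
  "ex (Cond b c d) s r s' \<longleftrightarrow> (if test b s then ex c s r s' else ex d s r s')"
  by (auto intro: ex_CondT ex_CondF elim: ex.cases)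

definition emit :: "nat list \<Rightarrow> com" where "emit s = Seq (items s) (Do MvR)"

text \<open>One step of the translation: the head stands on the first symbol of a formula or term, and
  moves to the first symbol of its first immediate subformula or, if there is none, beyond it.\<close>

definition node :: com where
  "node =
    Cond (tS {8}) (Seq (macro cap_p) (Seq (Do MvR) (tok (tEq (n vQ) tC))))
   (Cond (tS {9}) (emit [24])
   (Cond (tS {10}) (emit [23])
   (Cond (tS {11}) (emit next_t)
   (Cond (tS {12}) (emit until_t)
   (Cond (tS {13}) (Seq (macro ce_p) (Do MvR))
   (Cond (tS {14}) (Seq (Do MvR) (tok (tExEq tT (tV (n vI)))))
   (Cond (tS {15}) (emit le_t)
   (Cond (tS {16}) (Seq (Do MvR) (Cond (tS {4}) (Seq (Do MvR) (tok (const_t True)))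
      (Seq (Do MvR) (tok (const_t False)))))
   (Cond (tS {17}) (Seq (Do MvR) (Seq (Cond (tS {4}) (Seq (Do MvR) (tok (count_t True)))
      (Seq (Do MvR) (tok (count_t False)))) (tok count_t')))
   (emit add_t))))))))))"

definition main :: com where "main = Loop (\<lambda>x p l. x \<noteq> 0) node"

lemma ex_emit: "set s \<subseteq> {0<..<27} \<Longrightarrow> ex (emit s) (u, c # v, p) s (c # u, v, p)"
  unfolding emit_def by (rule ex_SeqI[OF ex_outs ex_MvR]) simp_all

lemma main_step:
  assumes "ex node (u, c # v, None) r1 s1" "c \<noteq> 0" "ex main s1 r2 s2" "r = r1 @ r2"
  shows "ex main (u, c # v, None) r s2"
  using assms unfolding main_def by (intro ex_LoopI[OF _ assms(1)]) (auto simp: test_def)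

lemma ex_tok_right:
  "set cs \<subseteq> {..<27} \<Longrightarrow> c \<notin> {1, 2} \<Longrightarrow>
    ex (Seq (Do MvR) (tok cs)) (u, c # enc_nat x @ v, p) (sem cs x) (rev (enc_nat x) @ c # u, v, p)"
  by (rule ex_SeqI[OF ex_MvR ex_tok]) auto

lemma t_range:
  "set next_t \<subseteq> {0<..<27}" "set until_t \<subseteq> {0<..<27}" "set le_t \<subseteq> {0<..<27}" "set add_t \<subseteq> {0<..<27}"
  "set (const_t b) \<subseteq> {..<27}" "set (count_t b) \<subseteq> {..<27}" "set count_t' \<subseteq> {..<27}"
  "set zero_t \<subseteq> {..<27}"
  by (simp_all add: next_t_def until_t_def le_t_def add_t_def const_t_def count_t_def count_t'_def zero_t_def)

text \<open>The head is behind the structure, as macros require.\<close>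

definition inK :: "kripke \<Rightarrow> nat list \<Rightarrow> bool" where "inK K u \<longleftrightarrow> (\<exists>u'. u = u' @ rev (enc_kripke K))"

lemma inK_Cons [simp]: "inK K u \<Longrightarrow> inK K (c # u)"
  unfolding inK_def by (metis append_Cons)

lemma inK_append [simp]: "inK K u \<Longrightarrow> inK K (xs @ u)"
  unfolding inK_def by (metis append_assoc)

lemma node_atom: "inK K u \<Longrightarrow> ex node (u, 8 # enc_nat p @ v, None)
    (em K cap_p @ sem (tEq (n vQ) tC) p) (rev (enc_nat p) @ 8 # u, v, None)"
proof -
  assume "inK K u"
  then have "ex (macro cap_p) (u, 8 # enc_nat p @ v, None) (em K cap_p) (u, 8 # enc_nat p @ v, None)"
    unfolding inK_def using ex_macro[OF pass_ok_macros(1)] by blast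
  moreover have "ex (Seq (Do MvR) (tok (tEq (n vQ) tC))) (u, 8 # enc_nat p @ v, None)
      (sem (tEq (n vQ) tC) p) (rev (enc_nat p) @ 8 # u, v, None)"
    by (rule ex_tok_right) simp_all
  ultimately show ?thesis unfolding node_def by (simp add: test_def) (rule ex_SeqI, assumption+, simp)
qed

lemma node_E: "inK K u \<Longrightarrow> ex node (u, 13 # v, None) (em K ce_p) (13 # u, v, None)"
proof -
  assume "inK K u"
  then have "ex (macro ce_p) (u, 13 # v, None) (em K ce_p) (u, 13 # v, None)"
    unfolding inK_def using ex_macro[OF pass_ok_macros(2)] by blast
  from ex_SeqI[OF this ex_MvR refl] show ?thesis unfolding node_def by (simp add: test_def)
qed

lemma node_emit:
  "ex node (u, 9 # v, None) [24] (9 # u, v, None)"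
  "ex node (u, 10 # v, None) [23] (10 # u, v, None)"
  "ex node (u, 11 # v, None) next_t (11 # u, v, None)"
  "ex node (u, 12 # v, None) until_t (12 # u, v, None)"
  "ex node (u, 15 # v, None) le_t (15 # u, v, None)"
  "ex node (u, 18 # v, None) add_t (18 # u, v, None)"
  unfolding node_def by (simp_all add: test_def ex_emit t_range)

lemma node_bind: "ex node (u, 14 # enc_nat x @ v, None) (sem (tExEq tT (tV (n vI))) x)
    (rev (enc_nat x) @ 14 # u, v, None)"
proof -
  have "set (tExEq tT (tV (n vI))) \<subseteq> {..<27}" by simp
  from ex_tok_right[OF this] show ?thesis unfolding node_def by (simp add: test_def)
qed

lemma node_const: "ex node (u, 16 # enc_int a @ v, None) (sem (const_t (0 \<le> a)) (nat \<bar>a\<bar>))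
    (rev (enc_int a) @ 16 # u, v, None)"
proof -
  have "ex (Seq (Do MvR) (tok (const_t b))) (16 # u, c # enc_nat x @ v, None) (sem (const_t b) x)
      (rev (enc_nat x) @ c # 16 # u, v, None)" if "c \<notin> {1, 2}" for b c x
    by (rule ex_tok_right[OF t_range(5) that])
  then have "ex (Cond (tS {4}) (Seq (Do MvR) (tok (const_t True))) (Seq (Do MvR) (tok (const_t False))))
      (16 # u, enc_int a @ v, None) (sem (const_t (0 \<le> a)) (nat \<bar>a\<bar>)) (rev (enc_int a) @ 16 # u, v, None)"
    by (simp add: test_def enc_int_def)
  from ex_SeqI[OF ex_MvR this refl] show ?thesis unfolding node_def by (simp add: test_def)
qed

lemma node_count: "ex node (u, 17 # enc_int a @ enc_nat x @ v, None)
    (sem (count_t (0 \<le> a)) (nat \<bar>a\<bar>) @ sem count_t' x) (rev (enc_nat x) @ rev (enc_int a) @ 17 # u, v, None)"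
proof -
  have "ex (Seq (Do MvR) (tok (count_t b))) (17 # u, c # enc_nat y @ w, None) (sem (count_t b) y)
      (rev (enc_nat y) @ c # 17 # u, w, None)" if "c \<notin> {1, 2}" for b c y w
    by (rule ex_tok_right[OF t_range(6) that])
  then have 1: "ex (Cond (tS {4}) (Seq (Do MvR) (tok (count_t True))) (Seq (Do MvR) (tok (count_t False))))
      (17 # u, enc_int a @ enc_nat x @ v, None) (sem (count_t (0 \<le> a)) (nat \<bar>a\<bar>))
      (rev (enc_int a) @ 17 # u, enc_nat x @ v, None)"
    by (simp add: test_def enc_int_def)
  have "gd (rev (enc_int a) @ 17 # u)" by (simp add: enc_int_def)
  from ex_SeqI[OF ex_MvR ex_SeqI[OF 1 ex_tok[OF t_range(7) this] refl] refl]
  show ?thesis unfolding node_def by (simp add: test_def)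
qed

text \<open>Here \<open>r\<close> is what the loop outputs for everything behind the formula. With
  this continuation the induction goes through for a loop without a stack: prefix order lets
  subformulas simply follow each other.\<close>

lemma main_formula:
  "inK K u \<Longrightarrow> ex main (rev (enc_cform f) @ u, v, None) r s \<Longrightarrow>
     ex main (u, enc_cform f @ v, None) (enc_ph (tr K f) @ r) s"
  "inK K u \<Longrightarrow> ex main (rev (enc_cterm t) @ u, v, None) r s \<Longrightarrow>
     ex main (u, enc_cterm t @ v, None) (enc_ph (trv K t) @ r) s"
proof (induction f and t arbitrary: u v r and u v r)
  case (CAP p)
  show ?case using main_step[OF node_atom[OF CAP(1)] _ _ refl] CAP(2)
    by (simp add: enc_tr del: tr.simps)
next
  case (CAnd f g)
  have "ex main (9 # u, enc_cform f @ enc_cform g @ v, None) (enc_ph (tr K f) @ enc_ph (tr K g) @ r) s"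
    by (intro CAnd.IH) (use CAnd.prems in auto)
  from main_step[OF node_emit(1) _ this refl] show ?case by simp
next
  case (CNot f)
  have "ex main (10 # u, enc_cform f @ v, None) (enc_ph (tr K f) @ r) s"
    by (intro CNot.IH) (use CNot.prems in auto)
  from main_step[OF node_emit(2) _ this refl] show ?case by simp
next
  case (CX f)
  have "ex main (11 # u, enc_cform f @ v, None) (enc_ph (tr K f) @ r) s"
    by (intro CX.IH) (use CX.prems in auto)
  from main_step[OF node_emit(3) _ this refl] show ?case by (simp add: enc_tr del: tr.simps trv.simps)
next
  case (CU f g)
  have "ex main (12 # u, enc_cform f @ enc_cform g @ v, None) (enc_ph (tr K f) @ enc_ph (tr K g) @ r) s"
    by (intro CU.IH) (use CU.prems in auto)
  from main_step[OF node_emit(4) _ this refl] show ?case by (simp add: enc_tr del: tr.simps trv.simps)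
next
  case (CE f)
  have "ex main (13 # u, enc_cform f @ v, None) (enc_ph (tr K f) @ r) s"
    by (intro CE.IH) (use CE.prems in auto)
  from main_step[OF node_E[OF CE.prems(1)] _ this refl] show ?case by (simp add: enc_tr del: tr.simps trv.simps)
next
  case (CBind x f)
  have "ex main (rev (enc_nat x) @ 14 # u, enc_cform f @ v, None) (enc_ph (tr K f) @ r) s"
    by (intro CBind.IH) (use CBind.prems in auto)
  from main_step[OF node_bind _ this refl] show ?case by (simp add: enc_tr del: tr.simps trv.simps)
next
  case (CLe t t')
  have "ex main (15 # u, enc_cterm t @ enc_cterm t' @ v, None) (enc_ph (trv K t) @ enc_ph (trv K t') @ r) s"
    by (intro CLe.IH) (use CLe.prems in auto)
  from main_step[OF node_emit(5) _ this refl] show ?case by (simp add: enc_tr del: tr.simps trv.simps)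
next
  case (CConst a)
  then have "ex main (rev (enc_int a) @ 16 # u, v, None) r s" by simp
  from main_step[OF node_const _ this refl] show ?case by (simp add: enc_tr del: tr.simps trv.simps)
next
  case (CCount a x f)
  have "ex main (rev (enc_nat x) @ rev (enc_int a) @ 17 # u, enc_cform f @ v, None) (enc_ph (tr K f) @ r) s"
    by (intro CCount.IH) (use CCount.prems in auto)
  from main_step[OF node_count _ this refl] show ?case by (simp add: enc_tr del: tr.simps trv.simps)
next
  case (CAdd t t')
  have "ex main (18 # u, enc_cterm t @ enc_cterm t' @ v, None) (enc_ph (trv K t) @ enc_ph (trv K t') @ r) s"
    by (intro CAdd.IH) (use CAdd.prems in auto)
  from main_step[OF node_emit(6) _ this refl] show ?case by (simp add: enc_tr del: tr.simps trv.simps)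
qed

section \<open>Zero constraints and the whole program\<close>

definition zeros :: com where
  "zeros = Loop (\<lambda>x p l. x \<noteq> 0) (Cond (tS digit) (tok zero_t) (Do MvR))"

lemma zeros_skip: "c \<notin> {0, 1, 2, 3} \<Longrightarrow> ex zeros (c # u, v, None) r s \<Longrightarrow> ex zeros (u, c # v, None) r s"
proof -
  assume c: "c \<notin> {0, 1, 2, 3}" and e: "ex zeros (c # u, v, None) r s"
  have "test (\<lambda>x p l. x \<noteq> 0) (u, c # v, None)" "ex (Cond (tS digit) (tok zero_t) (Do MvR)) (u, c # v, None) [] (c # u, v, None)"
    using c ex_MvR by (simp_all add: test_def)
  from ex_LoopI[OF this e[unfolded zeros_def] refl] show ?thesis unfolding zeros_def by simp
qed

lemma zeros_tok:
  assumes "gd u" "ex zeros (rev (enc_nat x) @ u, v, None) r s"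
  shows "ex zeros (u, enc_nat x @ v, None) (sem zero_t x @ r) s"
proof -
  have "rd (enc_nat x @ v) 0 \<in> digit" by (rule rd_enc)
  then have t: "test (\<lambda>x p l. x \<noteq> 0) (u, enc_nat x @ v, None)" "test (tS digit) (u, enc_nat x @ v, None)"
    unfolding test_def prod.case by auto
  have "ex (Cond (tS digit) (tok zero_t) (Do MvR)) (u, enc_nat x @ v, None) (sem zero_t x) (rev (enc_nat x) @ u, v, None)"
    by (rule ex_CondT[OF t(2) ex_tok[OF t_range(8) assms(1)]])
  from ex_LoopI[OF t(1) this assms(2)[unfolded zeros_def] refl] show ?thesis unfolding zeros_def .
qed

lemma zeros_formula:
  "ex zeros (rev (enc_cform f) @ u, v, None) r s \<Longrightarrow>
     ex zeros (u, enc_cform f @ v, None) (concat (map (sem zero_t) (toks f)) @ r) s"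
  "ex zeros (rev (enc_cterm t) @ u, v, None) r s \<Longrightarrow>
     ex zeros (u, enc_cterm t @ v, None) (concat (map (sem zero_t) (tokt t)) @ r) s"
proof (induction f and t arbitrary: u v r and u v r)
  case (CConst a)
  then show ?case by (auto simp: enc_int_def intro!: zeros_skip zeros_tok)
next
  case (CCount a x f)
  have "ex zeros (rev (enc_nat x) @ rev (enc_int a) @ 17 # u, enc_cform f @ v, None)
      (concat (map (sem zero_t) (toks f)) @ r) s"
    by (intro CCount.IH) (use CCount.prems in simp)
  then show ?case by (auto simp: enc_int_def intro!: zeros_skip zeros_tok)
qed (auto intro!: zeros_skip zeros_tok)

text \<open>The formula is read twice: the constraints on all its tokens come before the
  translation.\<close>

definition prog :: com where
  "prog = Seq (pass_com nil_pass) (Seq zeros (Seq (pass_com nil_pass) (Seq (passes_com top_p) main)))"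

lemma ex_prog:
  "ex prog ([], enc_instance K f, None) (enc_ph (red K f)) (rev (enc_cform f) @ rev (enc_kripke K), [], None)"
proof -
  let ?u = "rev (enc_kripke K)" and ?v = "enc_cform f"
  let ?w = "rev ?v @ ?u"
  have ok: "pass_ok nil_pass" by (simp add: nil_pass_def)
  have 1: "ex (pass_com nil_pass) ([], enc_instance K f, None) [] (?u, ?v, None)"
    using ex_pass[OF ok, of "[]" "enc_instance K f" K ?v None] by (simp add: nil_pass_def enc_instance_def)
  have "ex zeros (?w, [], None) [] (?w, [], None)"
    unfolding zeros_def by (rule ex_LoopF) (simp add: test_def)
  then have 2: "ex zeros (?u, ?v, None) (concat (map (sem zero_t) (toks f))) (?w, [], None)"
    using zeros_formula(1)[of f ?u "[]" "[]" "(?w, [], None)"] by simp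
  have 3: "ex (pass_com nil_pass) (?w, [], None) [] (?u, ?v, None)"
    using ex_pass[OF ok, of ?w "[]" K ?v None] by (simp add: nil_pass_def)
  have 4: "ex (passes_com top_p) (?u, ?v, None) (em K top_p) (?u, ?v, None)"
    by (rule ex_passes[OF pass_ok_macros(3)])
  have "ex main (?w, [], None) [] (?w, [], None)"
    unfolding main_def by (rule ex_LoopF) (simp add: test_def)
  then have 5: "ex main (?u, ?v, None) (enc_ph (tr K f)) (?w, [], None)"
    using main_formula(1)[of K ?u f "[]" "[]" "(?w, [], None)"] by (simp add: inK_def)
  show ?thesis unfolding prog_def
    by (rule ex_SeqI[OF 1 ex_SeqI[OF 2 ex_SeqI[OF 3 ex_SeqI[OF 4 5]]]]; simp add: enc_red)
qed

lemma enc_cform_range: "set (enc_cform f) \<subseteq> {0<..<27}" "set (enc_cterm t) \<subseteq> {0<..<27}"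
  by (induction f and t) (simp_all add: enc_int_def)

lemma enc_list_range: "(\<And>x. set (g x) \<subseteq> {0<..<27}) \<Longrightarrow> set (enc_list g xs) \<subseteq> {0<..<27}"
  by (induction xs) (simp_all add: enc_list_def)

lemma enc_instance_range: "set (enc_instance K f) \<subseteq> {0<..<27}"
proof -
  have "set (enc_list (\<lambda>(a, b). enc_nat a @ enc_nat b) (ks_edges K)) \<subseteq> {0<..<27}"
  proof (rule enc_list_range)
    show "set (case e of (a, b) \<Rightarrow> enc_nat a @ enc_nat b) \<subseteq> {0<..<27}" for e
      by (cases e) simp
  qed
  moreover have "set (enc_list (enc_list enc_nat) (ks_labels K)) \<subseteq> {0<..<27}"
    by (intro enc_list_range enc_nat_range)
  ultimately show ?thesis
    using enc_cform_range(1)[of f] by (simp add: enc_instance_def enc_kripke_def)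
qed

theorem theorem15:
  shows "\<exists>f. polytime_reduction_map f \<and>
           (\<forall>K \<Phi>. FKS K \<longrightarrow> (ph_satisfiable (f K \<Phi>) \<longleftrightarrow> models K \<Phi>))"
proof (intro exI conjI allI impI)
  obtain M k d where "tm_wf M" "\<forall>w r s. sy w \<longrightarrow> ex prog ([], w, None) r s \<longrightarrow>
      tm_computes_within M (k * (length w + 1) ^ d) w r"
    using com_polytime[of prog] by blast
  then show "polytime_reduction_map red"
    unfolding polytime_reduction_map_def using ex_prog enc_instance_range by blast
qed (rule red_correct)

end
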